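(* Let $G$ be an infinite graph. Then $G$ has a thick end if and only if the hexagonal quarter grid $H^{\infty}$ is a topological minor of $G$.
   Context: Graphs are simple and undirected. A ray is a one-way infinite path (a graph with distinct vertices $x_0,x_1,x_2,\dots$ and edges $x_ix_{i+1}$, $i\ge 0$). Two rays in a graph $G$ are equivalent if for every finite vertex set $S\subset V(G)$ both rays have a tail in the same component of $G-S$ (equivalently, there are infinitely many pairwise disjoint paths in $G$ between them). An end of $G$ is an equivalence class of rays in $G$ under this relation. An end is thick if it contains an infinite set of pairwise (vertex-)disjoint rays. The hexagonal quarter grid $H^{\infty}$ (following R. Diestel's book Graph Theory, 5th ed., Springer, 2017) is the graph obtained from the grid on $\mathbb{N}^2$ (with $\mathbb{N}=\{0,1,2,\dots\}$, where $(n,m)$ and $(n',m')$ are adjacent iff $|n-n'|+|m-m'|=1$) by deleting the vertex $(0,0)$, all vertices $(n,m)$ with $n>m$, and all edges $(n,m)(n+1,m)$ such that $n$ and $m$ have equal parity. A graph $X$ is a topological minor of $G$ if $G$ contains a subgraph that is a subdivision of $X$, i.e. a graph obtained from $X$ by replacing its edges with internally disjoint finite paths (of length at least $1$) between their ends, with no inner vertex of these paths being a vertex of $X$. *)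

theory Defs
  imports Main
begin

record 'a graph =
  verts :: "'a set"
  edges :: "'a set set"

definition simple_graph :: "'a graph \<Rightarrow> bool" where
  "simple_graph G \<longleftrightarrow> (\<forall>e\<in>edges G. e \<subseteq> verts G \<and> card e = 2)"

definition subgraph :: "'a graph \<Rightarrow> 'a graph \<Rightarrow> bool" where
  "subgraph H G \<longleftrightarrow> simple_graph H \<and> verts H \<subseteq> verts G \<and> edges H \<subseteq> edges G"

definition delete_verts :: "'a graph \<Rightarrow> 'a set \<Rightarrow> 'a graph" where
  "delete_verts G S = \<lparr>verts = verts G - S, edges = {e \<in> edges G. e \<inter> S = {}}\<rparr>"

definition delete_edges :: "'a graph \<Rightarrow> 'a set set \<Rightarrow> 'a graph" where
  "delete_edges G F = \<lparr>verts = verts G, edges = edges G - F\<rparr>"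

definition linked :: "'a graph \<Rightarrow> ('a \<times> 'a) set" where
  "linked G = {(u, v). u \<in> verts G \<and> v \<in> verts G \<and> (u, v) \<in> {(a, b). {a, b} \<in> edges G}\<^sup>*}"

text \<open>A component is represented by its vertex set.\<close>

definition components :: "'a graph \<Rightarrow> 'a set set" where
  "components G = verts G // linked G"

text \<open>
  A ray is represented by the sequence of its vertices, listed from its unique vertex of
  degree one; this sequence is determined by the ray as a graph, and conversely.
\<close>

definition rays :: "'a graph \<Rightarrow> (nat \<Rightarrow> 'a) set" where
  "rays G = {x. inj x \<and> range x \<subseteq> verts G \<and> (\<forall>i. {x i, x (Suc i)} \<in> edges G)}"

definition ray_equiv :: "'a graph \<Rightarrow> ((nat \<Rightarrow> 'a) \<times> (nat \<Rightarrow> 'a)) set" where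
  "ray_equiv G = {(x, y). x \<in> rays G \<and> y \<in> rays G \<and>
     (\<forall>S. finite S \<and> S \<subseteq> verts G \<longrightarrow>
        (\<exists>C\<in>components (delete_verts G S). \<exists>m n. x ` {m..} \<subseteq> C \<and> y ` {n..} \<subseteq> C))}"

definition ends :: "'a graph \<Rightarrow> (nat \<Rightarrow> 'a) set set" where
  "ends G = rays G // ray_equiv G"

definition thick :: "(nat \<Rightarrow> 'a) set \<Rightarrow> bool" where
  "thick \<omega> \<longleftrightarrow> (\<exists>R\<subseteq>\<omega>. infinite R \<and> pairwise (\<lambda>x y. disjnt (range x) (range y)) R)"

definition nat_grid :: "(nat \<times> nat) graph" where
  "nat_grid = \<lparr>verts = UNIV,
     edges = {{(n, m), (n', m')} | n m n' m'.
                \<bar>int n - int n'\<bar> + \<bar>int m - int m'\<bar> = 1}\<rparr>"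

definition hex_quarter_grid :: "(nat \<times> nat) graph" where
  "hex_quarter_grid =
     delete_edges
       (delete_verts nat_grid ({(0, 0)} \<union> {(n, m). n > m}))
       {{(n, m), (n + 1, m)} | n m. even n \<longleftrightarrow> even m}"

text \<open>A finite path of length at least one is represented by the list of its vertices.\<close>

definition path_list :: "'a list \<Rightarrow> bool" where
  "path_list p \<longleftrightarrow> distinct p \<and> length p \<ge> 2"

definition path_edges :: "'a list \<Rightarrow> 'a set set" where
  "path_edges p = {{p ! i, p ! Suc i} | i. Suc i < length p}"

definition inner_verts :: "'a list \<Rightarrow> 'a set" where
  "inner_verts p = set (butlast (tl p))"

text \<open>
  Subdivisions are taken up to isomorphism: \<open>\<phi>\<close> embeds the vertices of \<open>X\<close> as branch vertices
  of \<open>H\<close>, and \<open>P e\<close> is the path that replaces the edge \<open>e\<close> (traversed in either direction).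
\<close>

definition subdivision_of :: "'b graph \<Rightarrow> 'a graph \<Rightarrow> bool" where
  "subdivision_of X H \<longleftrightarrow>
     (\<exists>\<phi> P. inj_on \<phi> (verts X) \<and>
        (\<forall>e\<in>edges X. path_list (P e) \<and> {hd (P e), last (P e)} = \<phi> ` e \<and>
                      inner_verts (P e) \<inter> \<phi> ` verts X = {}) \<and>
        (\<forall>e\<in>edges X. \<forall>f\<in>edges X. e \<noteq> f \<longrightarrow> inner_verts (P e) \<inter> inner_verts (P f) = {}) \<and>
        verts H = \<phi> ` verts X \<union> (\<Union>e\<in>edges X. set (P e)) \<and>
        edges H = (\<Union>e\<in>edges X. path_edges (P e)))"

definition topological_minor :: "'b graph \<Rightarrow> 'a graph \<Rightarrow> bool" where
  "topological_minor X G \<longleftrightarrow> (\<exists>H. subgraph H G \<and> subdivision_of X H)"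

lemma equiv_linked: "equiv (verts G) (linked G)"
proof (rule equivI)
  show "linked G \<subseteq> verts G \<times> verts G"
    by (auto simp: linked_def)
  show "refl_on (verts G) (linked G)"
    by (auto simp: linked_def refl_on_def)
  have "sym ({(a, b). {a, b} \<in> edges G}\<^sup>*)"
    by (rule sym_rtrancl) (auto simp: sym_def insert_commute)
  then show "sym (linked G)"
    by (auto simp: linked_def sym_def)
  show "trans (linked G)"
    unfolding linked_def by (auto intro!: transI intro: rtrancl_trans)
qed

lemma ray_tail_in_component:
  assumes x: "x \<in> rays G" and S: "finite S"
  shows "\<exists>C\<in>components (delete_verts G S). \<exists>m. x ` {m..} \<subseteq> C"
proof -
  let ?D = "delete_verts G S"
  have "finite (x -` S)"
    using x S by (intro finite_vimageI) (auto simp: rays_def)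
  then obtain m where m: "\<And>i. x i \<in> S \<Longrightarrow> i < m"
    by (metis finite_nat_set_iff_bounded vimageI)
  have verts: "x i \<in> verts ?D" if "m \<le> i" for i
    using x m[of i] that by (auto simp: rays_def delete_verts_def)
  have edge: "{x i, x (Suc i)} \<in> edges ?D" if "m \<le> i" for i
    using x m[of i] m[of "Suc i"] that by (auto simp: rays_def delete_verts_def)
  have "(x m, x i) \<in> {(a, b). {a, b} \<in> edges ?D}\<^sup>*" if "m \<le> i" for i
    using that
  proof (induction i rule: dec_induct)
    case (step i)
    then show ?case
      using edge[of i] by (auto intro: rtrancl_into_rtrancl)
  qed simp
  then have "x ` {m..} \<subseteq> linked ?D `` {x m}"
    using verts by (auto simp: linked_def)
  moreover have "linked ?D `` {x m} \<in> components ?D"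
    using verts[of m] by (auto simp: components_def intro: quotientI)
  ultimately show ?thesis by blast
qed

lemma equiv_ray_equiv: "equiv (rays G) (ray_equiv G)"
proof (rule equivI)
  show "ray_equiv G \<subseteq> rays G \<times> rays G"
    by (auto simp: ray_equiv_def)
  show "refl_on (rays G) (ray_equiv G)"
    unfolding refl_on_def
  proof
    fix x assume x: "x \<in> rays G"
    have "\<exists>C\<in>components (delete_verts G S). \<exists>m n. x ` {m..} \<subseteq> C \<and> x ` {n..} \<subseteq> C"
      if "finite S" for S
      using ray_tail_in_component[OF x that] by metis
    with x show "(x, x) \<in> ray_equiv G"
      by (simp add: ray_equiv_def)
  qed
  show "sym (ray_equiv G)"
    unfolding ray_equiv_def by (rule symI) (simp, metis)
  show "trans (ray_equiv G)"
  proof (rule transI)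
    fix x y z
    assume xy: "(x, y) \<in> ray_equiv G" and yz: "(y, z) \<in> ray_equiv G"
    have "\<exists>C\<in>components (delete_verts G S). \<exists>m n. x ` {m..} \<subseteq> C \<and> z ` {n..} \<subseteq> C"
      if S: "finite S" "S \<subseteq> verts G" for S
    proof -
      obtain C m n where C: "C \<in> components (delete_verts G S)"
        "x ` {m..} \<subseteq> C" "y ` {n..} \<subseteq> C"
        using xy S by (simp add: ray_equiv_def) metis
      obtain D k l where D: "D \<in> components (delete_verts G S)"
        "y ` {k..} \<subseteq> D" "z ` {l..} \<subseteq> D"
        using yz S by (simp add: ray_equiv_def) metis
      have "y (max n k) \<in> C \<inter> D"
        using C(3) D(2) by auto
      then have "C = D"
        using quotient_disj[OF equiv_linked C(1)[unfolded components_def]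
            D(1)[unfolded components_def]] by auto
      with C D show ?thesis by metis
    qed
    then show "(x, z) \<in> ray_equiv G"
      using xy yz by (simp add: ray_equiv_def)
  qed
qed

lemma simple_graph_hex_quarter_grid: "simple_graph hex_quarter_grid"
  unfolding simple_graph_def
proof (intro ballI conjI)
  fix e assume "e \<in> edges hex_quarter_grid"
  then have e: "e \<in> edges nat_grid" "e \<inter> ({(0, 0)} \<union> {(n, m). n > m}) = {}"
    by (simp_all add: hex_quarter_grid_def delete_edges_def delete_verts_def)
  then show "e \<subseteq> verts hex_quarter_grid"
    by (simp add: hex_quarter_grid_def delete_edges_def delete_verts_def nat_grid_def) blast
  obtain n m n' m' where "e = {(n, m), (n', m')}"
    and "\<bar>int n - int n'\<bar> + \<bar>int m - int m'\<bar> = 1"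
    using e(1) unfolding nat_grid_def by auto
  then show "card e = 2"
    by (auto simp: card_insert_if)
qed

end

theory Submission
  imports Defs "HOL-Library.Ramsey"
begin

text \<open>
  This is Halin's grid theorem. The harder direction starts from infinitely many disjoint equivalent
  rays \<open>r 0, r 1, \<dots>\<close> and finds a subdivided grid whose columns are tails of some
  of these very rays, without rerouting any of them; only Ramsey's theorem decides which rays are
  kept.

  Since the rays are equivalent, there are, after thinning out the rays, disjoint finite vertex sets
  \<open>D 1, D 2, \<dots>\<close> (the levels) such that the rays with index below \<open>k\<close>
  can all be linked to each other within \<open>D k\<close>, while the other rays miss \<open>D
  k\<close>, and such that every ray meets \<open>D k\<close> in a segment (\<open>levels\<close>).
  Contracting these segments turns level \<open>k\<close> into a connected graph on the ray indices
  below \<open>k\<close>. These graphs may differ completely from level to level. However, their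
  paths towards the root \<open>0\<close> order the indices, and Ramsey's theorem for the triples
  \<open>i < j < k\<close>, coloured by how \<open>i\<close> and \<open>j\<close> compare on level
  \<open>k\<close>, yields an infinite set \<open>J\<close> of indices on which the comparison is
  always the same. In each of the three cases any two consecutive elements of \<open>J\<close> are
  joined, on all later levels with index in \<open>J\<close>, by a path that avoids the remaining
  elements of \<open>J\<close> (\<open>consecutive_links\<close>). Going back to the graph, any two
  consecutive rays with index in \<open>J\<close> are linked outside every finite set by a path that
  avoids all other rays of \<open>J\<close> (\<open>linked_subsequence\<close>). The rungs of the
  grid are then chosen one after the other, row by row, each above everything chosen before
  (\<open>rung_system\<close>, \<open>hex_minor\<close>).

  Conversely, every column of a subdivided grid is a ray, and the infinitely many disjoint rungs
  between two neighbouring columns make these rays equivalent (\<open>hex_minor_thick_end\<close>).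
\<close>

section \<open>A Ramsey argument for sequences of connected graphs on the natural numbers\<close>

lemma rtrancl_between:
  assumes "(i, j) \<in> T\<^sup>*" and "\<And>c. (i, c) \<in> T\<^sup>* \<Longrightarrow> (c, j) \<in> T\<^sup>* \<Longrightarrow> c \<in> I"
  shows "(i, j) \<in> (T \<inter> I \<times> I)\<^sup>*"
  using assms
proof (induction rule: rtrancl_induct)
  case (step y z)
  have "(i, y) \<in> (T \<inter> I \<times> I)\<^sup>*"
    by (rule step.IH) (simp add: step.prems rtrancl_into_rtrancl[OF _ step.hyps(2)])
  moreover have "y \<in> I" "z \<in> I"
    using step.hyps step.prems by (auto intro: rtrancl_into_rtrancl)
  ultimately show ?case
    using step.hyps by (auto intro: rtrancl_into_rtrancl)
qed simp

text \<open>
  Keep only the steps of \<open>Q\<close> that decrease the distance to \<open>r\<close>. The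
  reflexive transitive closure of what remains is then a partial order in which everything that
  reaches \<open>r\<close> still does.
\<close>

lemma acyclic_subrelation_to_root:
  obtains T where "T \<subseteq> Q" "acyclic T" "\<And>i. (i, r) \<in> Q\<^sup>* \<Longrightarrow> (i, r) \<in> T\<^sup>*"
proof
  define d where "d i = (LEAST n. (i, r) \<in> Q ^^ n)" for i
  define T where "T = {(i, j) \<in> Q. d j < d i}"
  show "T \<subseteq> Q" by (auto simp: T_def)
  have "T \<subseteq> (measure d)\<inverse>"
    by (auto simp: T_def)
  then show "acyclic T"
    by (meson acyclic_converse acyclic_subset wf_acyclic wf_measure)
  show "(i, r) \<in> T\<^sup>*" if "(i, r) \<in> Q\<^sup>*" for i
    using that
  proof (induction "d i" arbitrary: i rule: less_induct)
    case less
    have d: "(i, r) \<in> Q ^^ d i"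
      unfolding d_def using less.prems by (auto simp: rtrancl_power intro: LeastI)
    show ?case
    proof (cases "d i")
      case 0
      then show ?thesis using d by simp
    next
      case (Suc m)
      then obtain j where j: "(i, j) \<in> Q" "(j, r) \<in> Q ^^ m"
        using d relpow_Suc_D2 by metis
      have "d j \<le> m"
        unfolding d_def using j(2) by (rule Least_le)
      then have "d j < d i" using Suc by simp
      moreover have "(j, r) \<in> T\<^sup>*"
        using calculation j(2) by (intro less.hyps) (auto simp: rtrancl_power)
      ultimately show ?thesis
        using j(1) by (auto simp: T_def intro: converse_rtrancl_into_rtrancl)
    qed
  qed
qed

lemma ordered_triple_eq:
  fixes i :: nat
  assumes "{i, j, k} = {i', j', k'}" "i < j" "j < k" "i' < j'" "j' < k'"
  shows "i = i' \<and> j = j' \<and> k = k'"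
proof -
  have "Min {i, j, k} = i" "Max {i, j, k} = k" "Min {i', j', k'} = i'" "Max {i', j', k'} = k'"
    using assms(2-) by auto
  then have ik: "i = i'" "k = k'"
    using assms(1) by simp_all
  have "j \<in> {i', j', k'}"
    using assms(1) by auto
  then show ?thesis
    using ik assms(2,3) by auto
qed

text \<open>
  Ramsey's theorem for sets of three numbers, with the colours given by predicates on increasing
  triples: the colour tells whether \<open>A\<close> holds, or only \<open>B\<close>, or neither.
\<close>

lemma Ramsey_triples:
  fixes A B :: "nat \<Rightarrow> nat \<Rightarrow> nat \<Rightarrow> bool"
  obtains J where "infinite J"
    and "(\<forall>i\<in>J. \<forall>j\<in>J. \<forall>k\<in>J. i < j \<longrightarrow> j < k \<longrightarrow> A i j k) \<or>
         (\<forall>i\<in>J. \<forall>j\<in>J. \<forall>k\<in>J. i < j \<longrightarrow> j < k \<longrightarrow> B i j k) \<or>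
         (\<forall>i\<in>J. \<forall>j\<in>J. \<forall>k\<in>J. i < j \<longrightarrow> j < k \<longrightarrow> \<not> A i j k \<and> \<not> B i j k)"
proof -
  define f where "f X = (if \<exists>i j k. X = {i, j, k} \<and> i < j \<and> j < k \<and> A i j k then 0
     else if \<exists>i j k. X = {i, j, k} \<and> i < j \<and> j < k \<and> B i j k then 1 else 2 :: nat)" for X
  have f: "f {i, j, k} = (if A i j k then 0 else if B i j k then 1 else 2)" if "i < j" "j < k" for i j k
  proof -
    have "(\<exists>i' j' k'. {i, j, k} = {i', j', k'} \<and> i' < j' \<and> j' < k' \<and> C i' j' k') \<longleftrightarrow> C i j k" for C
    proof
      assume "\<exists>i' j' k'. {i, j, k} = {i', j', k'} \<and> i' < j' \<and> j' < k' \<and> C i' j' k'"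
      then obtain i' j' k' where "{i, j, k} = {i', j', k'}" "i' < j'" "j' < k'" "C i' j' k'"
        by blast
      then show "C i j k" using ordered_triple_eq[of i j k i' j' k'] that by simp
    next
      assume "C i j k"
      then show "\<exists>i' j' k'. {i, j, k} = {i', j', k'} \<and> i' < j' \<and> j' < k' \<and> C i' j' k'"
        using that by (intro exI[of _ i] exI[of _ j] exI[of _ k] conjI refl)
    qed
    then show ?thesis by (simp only: f_def)
  qed
  have f3: "f X < 3" for X
  proof -
    have "(if P then 0 else if P' then 1 else 2 :: nat) < 3" for P P' by simp
    then show ?thesis unfolding f_def by this
  qed
  have "\<exists>J t. J \<subseteq> UNIV \<and> infinite J \<and> t < 3 \<and> (\<forall>X. X \<subseteq> J \<and> finite X \<and> card X = 3 \<longrightarrow> f X = t)"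
    using f3 by (intro Ramsey) auto
  then obtain J t where J: "infinite J"
    and "\<forall>X. X \<subseteq> J \<and> finite X \<and> card X = 3 \<longrightarrow> f X = t"
    by (elim exE conjE) (rule that)
  then have t: "\<And>X. X \<subseteq> J \<and> finite X \<and> card X = 3 \<Longrightarrow> f X = t"
    by (elim allE impE)
  have ft: "f {i, j, k} = t" if "i \<in> J" "j \<in> J" "k \<in> J" "i < j" "j < k" for i j k
    using that by (intro t) auto
  have colour: "(t = 0 \<longrightarrow> A i j k) \<and> (t = 1 \<longrightarrow> B i j k) \<and> (t \<noteq> 0 \<and> t \<noteq> 1 \<longrightarrow> \<not> A i j k \<and> \<not> B i j k)"
    if "i \<in> J" "j \<in> J" "k \<in> J" "i < j" "j < k" for i j k
  proof -
    have "(if A i j k then 0 else if B i j k then 1 else 2) = t"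
      by (rule trans[OF f[OF that(4,5), symmetric] ft[OF that]])
    have *: "(if a then 0 else if b then 1 else 2) = t \<Longrightarrow>
      (t = 0 \<longrightarrow> a) \<and> (t = 1 \<longrightarrow> b) \<and> (t \<noteq> 0 \<and> t \<noteq> 1 \<longrightarrow> \<not> a \<and> \<not> b)" for a b
      by (cases a; cases b) auto
    show ?thesis by (rule *) fact
  qed
  show ?thesis
  proof (rule that[OF J])
    consider "t = 0" | "t = 1" | "t \<noteq> 0 \<and> t \<noteq> 1" by fast
    then show "(\<forall>i\<in>J. \<forall>j\<in>J. \<forall>k\<in>J. i < j \<longrightarrow> j < k \<longrightarrow> A i j k) \<or>
         (\<forall>i\<in>J. \<forall>j\<in>J. \<forall>k\<in>J. i < j \<longrightarrow> j < k \<longrightarrow> B i j k) \<or>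
         (\<forall>i\<in>J. \<forall>j\<in>J. \<forall>k\<in>J. i < j \<longrightarrow> j < k \<longrightarrow> \<not> A i j k \<and> \<not> B i j k)"
    proof cases
      case 1
      have *: "A i j k" if "i \<in> J" "j \<in> J" "k \<in> J" "i < j" "j < k" for i j k
        using colour[OF that] 1 by simp
      show ?thesis by (rule disjI1, intro ballI impI, rule *)
    next
      case 2
      have *: "B i j k" if "i \<in> J" "j \<in> J" "k \<in> J" "i < j" "j < k" for i j k
        using colour[OF that] 2 by simp
      show ?thesis by (rule disjI2, rule disjI1, intro ballI impI, rule *)
    next
      case 3
      have *: "\<not> A i j k \<and> \<not> B i j k" if "i \<in> J" "j \<in> J" "k \<in> J" "i < j" "j < k" for i j k
        using colour[OF that] 3 by simp
      show ?thesis by (rule disjI2, rule disjI2, intro ballI impI, rule *)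
    qed
  qed
qed

text \<open>
  Let \<open>T k \<subseteq> Q k\<close> be acyclic and contain a path from every \<open>i <
  k\<close> to \<open>0\<close>, and compare \<open>i\<close> and \<open>j\<close> on level
  \<open>k\<close> by reachability in \<open>T k\<close>. Let \<open>h\<close> enumerate a set of
  indices on which Ramsey's theorem makes the comparison uniform. If smaller numbers are always
  reachable from larger ones, take a path in \<open>T k\<close> from \<open>h (n + 1)\<close> to
  \<open>h n\<close>. Any chosen index on this path is below the level (larger ones do not occur
  there), so the comparison applies to it: it lies between the two in the order of \<open>T
  k\<close>, hence also as a number, so it is an end of the path. The case of larger numbers being
  reachable from smaller ones is symmetric. If distinct chosen indices are never comparable, then
  the paths from \<open>h n\<close> and from \<open>h (n + 1)\<close> to the root \<open>0\<close>
  contain no further chosen indices, and together they link \<open>h n\<close> to \<open>h (n +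
  1)\<close>.
\<close>

lemma consecutive_links:
  fixes Q :: "nat \<Rightarrow> (nat \<times> nat) set"
  assumes sym: "\<And>k. sym (Q k)"
    and field: "\<And>k. Q k \<subseteq> {..<k} \<times> {..<k}"
    and conn: "\<And>k i. i < k \<Longrightarrow> (i, 0) \<in> (Q k)\<^sup>*"
  obtains h :: "nat \<Rightarrow> nat" where "strict_mono h"
    and "\<And>n k. h (Suc n) < h k \<Longrightarrow>
      (h n, h (Suc n)) \<in> (Q (h k) \<inter> (- h ` (- {n, Suc n})) \<times> (- h ` (- {n, Suc n})))\<^sup>*"
proof -
  have "\<exists>T. T \<subseteq> Q k \<and> acyclic T \<and> (\<forall>i<k. (i, 0) \<in> T\<^sup>*)" for k
    using acyclic_subrelation_to_root[of "Q k" 0] conn by metis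
  then obtain T where T: "\<And>k. T k \<subseteq> Q k" "\<And>k. acyclic (T k)" "\<And>k i. i < k \<Longrightarrow> (i, 0) \<in> (T k)\<^sup>*"
    by metis
  have anti: "a = b" if "(a, b) \<in> (T k)\<^sup>*" "(b, a) \<in> (T k)\<^sup>*" for a b k
    using acyclic_impl_antisym_rtrancl[OF T(2)] that by (auto dest: antisymD)
  have below: "b < k" if "(a, b) \<in> (T k)\<^sup>*" "a < k" for a b k
    using that
  proof (induction rule: rtrancl_induct)
    case (step y z)
    then show ?case using T(1)[of k] field[of k] by blast
  qed
  obtain J where J: "infinite J" and cases:
    "(\<forall>i\<in>J. \<forall>j\<in>J. \<forall>k\<in>J. i < j \<longrightarrow> j < k \<longrightarrow> (j, i) \<in> (T k)\<^sup>*) \<or>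
     (\<forall>i\<in>J. \<forall>j\<in>J. \<forall>k\<in>J. i < j \<longrightarrow> j < k \<longrightarrow> (i, j) \<in> (T k)\<^sup>*) \<or>
     (\<forall>i\<in>J. \<forall>j\<in>J. \<forall>k\<in>J. i < j \<longrightarrow> j < k \<longrightarrow> (j, i) \<notin> (T k)\<^sup>* \<and> (i, j) \<notin> (T k)\<^sup>*)"
    by (rule Ramsey_triples[of "\<lambda>i j k. (j, i) \<in> (T k)\<^sup>*" "\<lambda>i j k. (i, j) \<in> (T k)\<^sup>*"])
  define h where "h = enumerate J"
  have mono: "strict_mono h"
    unfolding h_def strict_mono_def using J by simp
  have range: "range h = J"
    unfolding h_def using J by (rule range_enumerate)
  have hJ: "h n \<in> J" for n using range by blast
  show ?thesis
  proof (rule that[OF mono])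
    fix n k assume k: "h (Suc n) < h k"
    define I where "I = - h ` (- {n, Suc n})"
    have lt: "h n < h (Suc n)" using mono by (simp add: strict_mono_def)
    have I: "c \<in> I" if "\<And>m. c = h m \<Longrightarrow> m < n \<Longrightarrow> False" "\<And>m. c = h m \<Longrightarrow> Suc n < m \<Longrightarrow> False" for c
      unfolding I_def using that by (metis ComplI imageE ComplD insertI1 insertI2 less_antisym nat_neq_iff singletonI)
    have hk: "h m < h k" if "(a, h m) \<in> (T (h k))\<^sup>*" "a < h k" for a m
      using below that by blast
    have TQ: "(a, b) \<in> (Q (h k) \<inter> I \<times> I)\<^sup>*" if "(a, b) \<in> (T (h k) \<inter> I \<times> I)\<^sup>*" for a b
      using rtrancl_mono[of "T (h k) \<inter> I \<times> I" "Q (h k) \<inter> I \<times> I"] T(1) that by blast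
    have "sym (Q (h k) \<inter> I \<times> I)"
      using sym[of "h k"] by (auto simp: sym_def)
    then have symQ: "(b, a) \<in> (Q (h k) \<inter> I \<times> I)\<^sup>*" if "(a, b) \<in> (Q (h k) \<inter> I \<times> I)\<^sup>*" for a b
      using that by (meson sym_rtrancl symD)
    have less: "h a < h b \<longleftrightarrow> a < b" for a b
      using mono by (simp add: strict_mono_less)
    from cases have "(h n, h (Suc n)) \<in> (Q (h k) \<inter> I \<times> I)\<^sup>*"
    proof (elim disjE)
      assume c: "\<forall>i\<in>J. \<forall>j\<in>J. \<forall>k\<in>J. i < j \<longrightarrow> j < k \<longrightarrow> (j, i) \<in> (T k)\<^sup>*"
      have "(h (Suc n), h n) \<in> (T (h k) \<inter> I \<times> I)\<^sup>*"
      proof (rule rtrancl_between)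
        show "(h (Suc n), h n) \<in> (T (h k))\<^sup>*" using c hJ lt k by blast
      next
        fix x assume x: "(h (Suc n), x) \<in> (T (h k))\<^sup>*" "(x, h n) \<in> (T (h k))\<^sup>*"
        show "x \<in> I"
        proof (rule I)
          fix m assume m: "x = h m" "m < n"
          then have "(h n, x) \<in> (T (h k))\<^sup>*" using c hJ lt k less by (meson less_trans)
          then show False using anti[OF x(2)] m less[of m n] by simp
        next
          fix m assume m: "x = h m" "Suc n < m"
          then have "(x, h (Suc n)) \<in> (T (h k))\<^sup>*" using c hJ hk[of "h (Suc n)" m] x(1) k less by simp
          then show False using anti[OF x(1)] m less[of "Suc n" m] by simp
        qed
      qed
      then show ?thesis by (rule symQ[OF TQ])
    next
      assume c: "\<forall>i\<in>J. \<forall>j\<in>J. \<forall>k\<in>J. i < j \<longrightarrow> j < k \<longrightarrow> (i, j) \<in> (T k)\<^sup>*"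
      have "(h n, h (Suc n)) \<in> (T (h k) \<inter> I \<times> I)\<^sup>*"
      proof (rule rtrancl_between)
        show "(h n, h (Suc n)) \<in> (T (h k))\<^sup>*" using c hJ lt k by blast
      next
        fix x assume x: "(h n, x) \<in> (T (h k))\<^sup>*" "(x, h (Suc n)) \<in> (T (h k))\<^sup>*"
        show "x \<in> I"
        proof (rule I)
          fix m assume m: "x = h m" "m < n"
          then have "(x, h n) \<in> (T (h k))\<^sup>*" using c hJ lt k less by (meson less_trans)
          then show False using anti[OF x(1)] m less[of m n] by simp
        next
          fix m assume m: "x = h m" "Suc n < m"
          then have "(h (Suc n), x) \<in> (T (h k))\<^sup>*"
            using c hJ hk[of "h n" m] x(1) k lt less by simp
          then show False using anti[OF x(2)] m less[of "Suc n" m] by simp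
        qed
      qed
      then show ?thesis by (rule TQ)
    next
      assume c: "\<forall>i\<in>J. \<forall>j\<in>J. \<forall>k\<in>J. i < j \<longrightarrow> j < k \<longrightarrow> (j, i) \<notin> (T k)\<^sup>* \<and> (i, j) \<notin> (T k)\<^sup>*"
      have "(h a, 0) \<in> (T (h k) \<inter> I \<times> I)\<^sup>*" if a: "a \<in> {n, Suc n}" for a
      proof (rule rtrancl_between)
        have ak: "h a < h k" using a lt k by auto
        then show "(h a, 0) \<in> (T (h k))\<^sup>*" by (rule T(3))
        fix x assume x: "(h a, x) \<in> (T (h k))\<^sup>*"
        have "x = h m \<Longrightarrow> m = a" for m
          using c hJ hk[of "h a" m] x ak less by (metis linorder_neqE_nat)
        then show "x \<in> I" using a by (intro I) auto
      qed
      then have "(h a, 0) \<in> (Q (h k) \<inter> I \<times> I)\<^sup>*" if a: "a \<in> {n, Suc n}" for a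
        using TQ that by blast
      then show ?thesis using symQ by (meson insertI1 insertI2 rtrancl_trans)
    qed
    then show "(h n, h (Suc n)) \<in> (Q (h k) \<inter> (- h ` (- {n, Suc n})) \<times> (- h ` (- {n, Suc n})))\<^sup>*"
      unfolding I_def .
  qed
qed

section \<open>Linking a family of equivalent rays\<close>

text \<open>
  Adjacency in the subgraph induced by \<open>X\<close>. A pair in its reflexive transitive closure
  may be trivial, so that membership of the end vertices in \<open>X\<close> has to be recorded
  separately.
\<close>

definition adj :: "'a graph \<Rightarrow> 'a set \<Rightarrow> ('a \<times> 'a) set" where
  "adj G X = {(u, v). {u, v} \<in> edges G \<and> u \<in> X \<and> v \<in> X}"

lemma adj_rtrancl_mono: "X \<subseteq> Y \<Longrightarrow> (adj G X)\<^sup>* \<subseteq> (adj G Y)\<^sup>*"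
  by (intro rtrancl_mono) (auto simp: adj_def)

lemma adj_rtrancl_sym: "(u, v) \<in> (adj G X)\<^sup>* \<Longrightarrow> (v, u) \<in> (adj G X)\<^sup>*"
  using sym_rtrancl[of "adj G X"] by (auto simp: sym_def adj_def insert_commute)

lemma adj_rtrancl_step:
  "(u, v) \<in> (adj G X)\<^sup>* \<Longrightarrow> {v, w} \<in> edges G \<Longrightarrow> v \<in> X \<Longrightarrow> w \<in> X \<Longrightarrow> (u, w) \<in> (adj G X)\<^sup>*"
  by (erule rtrancl_into_rtrancl) (simp add: adj_def)

lemma adj_rtrancl_in: "(u, v) \<in> (adj G X)\<^sup>* \<Longrightarrow> u \<in> X \<Longrightarrow> v \<in> X"
  by (erule rtranclE) (auto simp: adj_def)

lemma finite_walk_support: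
  assumes "(u, v) \<in> (adj G X)\<^sup>*" "u \<in> X"
  shows "\<exists>Y\<subseteq>X. finite Y \<and> u \<in> Y \<and> v \<in> Y \<and> (u, v) \<in> (adj G Y)\<^sup>*"
  using assms
proof (induction rule: rtrancl_induct)
  case base
  then show ?case by (intro exI[of _ "{u}"]) simp
next
  case (step y z)
  then obtain Y where Y: "Y \<subseteq> X" "finite Y" "u \<in> Y" "y \<in> Y" "(u, y) \<in> (adj G Y)\<^sup>*"
    by auto
  have yz: "{y, z} \<in> edges G" "z \<in> X" using step.hyps by (auto simp: adj_def)
  have "(u, y) \<in> (adj G (insert z Y))\<^sup>*"
    using adj_rtrancl_mono[of Y "insert z Y" G] Y(5) by blast
  then have "(u, z) \<in> (adj G (insert z Y))\<^sup>*"
    using yz Y(4) by - (rule adj_rtrancl_step[of u y], auto)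
  then show ?case
    using Y yz by (intro exI[of _ "insert z Y"]) simp
qed

text \<open>
  The way in which equivalence of rays is used: outside every finite set there is a path between
  them.
\<close>

lemma ray_equiv_linked:
  assumes simple: "simple_graph G" and "(x, y) \<in> ray_equiv G" "finite S"
  shows "\<exists>u\<in>range x - S. \<exists>v\<in>range y - S. (u, v) \<in> (adj G (- S))\<^sup>*"
proof -
  let ?D = "delete_verts G (S \<inter> verts G)"
  obtain C m n where C: "C \<in> components ?D" "x ` {m..} \<subseteq> C" "y ` {n..} \<subseteq> C"
  proof -
    have "\<forall>S. finite S \<and> S \<subseteq> verts G \<longrightarrow> (\<exists>C\<in>components (delete_verts G S). \<exists>m n. x ` {m..} \<subseteq> C \<and> y ` {n..} \<subseteq> C)"
      using assms(2) by (simp add: ray_equiv_def)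
    from this[rule_format, of "S \<inter> verts G"] show thesis
      using assms(3) that by auto
  qed
  then have "x m \<in> C" "y n \<in> C" by auto
  then have "(x m, y n) \<in> linked ?D"
    using C(1) equiv_linked[of ?D] unfolding components_def by (meson quotient_eq_iff)
  then have *: "x m \<notin> S" "y n \<notin> S" "(x m, y n) \<in> {(a, b). {a, b} \<in> edges ?D}\<^sup>*"
    by (auto simp: linked_def delete_verts_def)
  have "x m \<in> - S \<Longrightarrow> (x m, y n) \<in> (adj G (- S))\<^sup>*"
    using *(3)
  proof (induction rule: rtrancl_induct)
    case (step a b)
    then have "{a, b} \<in> edges G" "a \<in> - S" "b \<in> - S" "(x m, a) \<in> (adj G (- S))\<^sup>*"
      using adj_rtrancl_in[of "x m" a G "- S"] simple by (auto simp: delete_verts_def simple_graph_def)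
    then show ?case by (rule adj_rtrancl_step[rotated])
  qed simp
  then show ?thesis using * by auto
qed

locale ray_family =
  fixes G :: "'a graph" and r :: "nat \<Rightarrow> nat \<Rightarrow> 'a"
  assumes simple: "simple_graph G"
    and rays: "r i \<in> rays G"
    and disjoint: "i \<noteq> j \<Longrightarrow> range (r i) \<inter> range (r j) = {}"
begin

lemma r_eq_iff: "r i m = r j n \<longleftrightarrow> i = j \<and> m = n"
proof (cases "i = j")
  case True
  then show ?thesis using rays[of i] by (auto simp: rays_def inj_eq)
next
  case False
  then show ?thesis using disjoint[of i j] by blast
qed

text \<open>
  A down-closed set meets every ray in an initial segment. The difference of two such sets therefore
  meets every ray in a connected segment, so that within this difference it is possible to move
  along the ray.
\<close>

definition down_closed :: "'a set \<Rightarrow> bool" where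
  "down_closed S \<longleftrightarrow> (\<forall>i m. r i (Suc m) \<in> S \<longrightarrow> r i m \<in> S)"

lemma down_closedD: "down_closed S \<Longrightarrow> r i n \<in> S \<Longrightarrow> m \<le> n \<Longrightarrow> r i m \<in> S"
  by (induction n) (auto simp: down_closed_def le_Suc_eq)

lemma finite_ray_indices:
  assumes "finite S"
  shows "finite {(i, n). r i n \<in> S}"
proof -
  have "inj (\<lambda>(i, n). r i n)" by (auto simp: inj_def r_eq_iff)
  then have "finite ((\<lambda>(i, n). r i n) -` S)" by (rule finite_vimageI[OF assms])
  moreover have "(\<lambda>(i, n). r i n) -` S = {(i, n). r i n \<in> S}" by auto
  ultimately show ?thesis by simp
qed

lemma finite_closure:
  assumes "finite S"
  obtains S' where "finite S'" "S \<subseteq> S'" "down_closed S'"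
proof
  let ?P = "{(i, n). r i n \<in> S}"
  let ?S = "S \<union> (\<Union>(i, n)\<in>?P. r i ` {..n})"
  show "finite ?S" using assms finite_ray_indices[OF assms] by auto
  show "down_closed ?S"
    unfolding down_closed_def by (auto simp: r_eq_iff image_iff)
qed simp

lemma segment_linked:
  assumes "down_closed S" "down_closed S'" "u \<in> range (r i) \<inter> (S' - S)" "v \<in> range (r i) \<inter> (S' - S)"
  shows "(u, v) \<in> (adj G (range (r i) \<inter> (S' - S)))\<^sup>*"
proof -
  let ?X = "range (r i) \<inter> (S' - S)"
  have "(r i a, r i b) \<in> (adj G ?X)\<^sup>*" if ab: "r i a \<in> ?X" "r i b \<in> ?X" "a \<le> b" for a b
    using ab(3) ab(2)
  proof (induction b rule: dec_induct)
    case (step n)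
    have n: "r i n \<in> ?X"
      using down_closedD[OF assms(2), of i "Suc n" n] down_closedD[OF assms(1), of i n a] ab(1) step by auto
    then show ?case
      using step rays[of i] by - (rule adj_rtrancl_step[OF step.IH[OF n]], (auto simp: rays_def))
  qed simp
  moreover obtain a b where "u = r i a" "v = r i b" using assms by auto
  ultimately show ?thesis
    using assms(3,4) adj_rtrancl_sym by (metis nat_le_linear)
qed

lemma next_level:
  assumes equiv: "\<And>i. (r i, r 0) \<in> ray_equiv G" and S: "finite S"
  shows "\<exists>S'. finite S' \<and> down_closed S' \<and> S \<subseteq> S' \<and>
    (\<forall>i\<le>N. \<exists>u\<in>range (r i) \<inter> (S' - S). \<exists>v\<in>range (r 0). (u, v) \<in> (adj G (S' - S))\<^sup>*)"
proof -
  have "\<exists>Y\<subseteq>-S. finite Y \<and> (\<exists>u\<in>range (r i) \<inter> Y. \<exists>v\<in>range (r 0). (u, v) \<in> (adj G Y)\<^sup>*)" for i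
  proof -
    obtain u v where uv: "u \<in> range (r i) - S" "v \<in> range (r 0) - S" "(u, v) \<in> (adj G (- S))\<^sup>*"
      using ray_equiv_linked[OF simple equiv S] by blast
    then show ?thesis using finite_walk_support[OF uv(3)] by blast
  qed
  then obtain Y where Y: "\<And>i. Y i \<subseteq> - S" "\<And>i. finite (Y i)"
    "\<And>i. \<exists>u\<in>range (r i) \<inter> Y i. \<exists>v\<in>range (r 0). (u, v) \<in> (adj G (Y i))\<^sup>*"
    by metis
  have "finite (S \<union> (\<Union>i\<le>N. Y i))" using S Y(2) by simp
  then obtain S' where S': "finite S'" "S \<union> (\<Union>i\<le>N. Y i) \<subseteq> S'" "down_closed S'"
    by (rule finite_closure)
  have "\<exists>u\<in>range (r i) \<inter> (S' - S). \<exists>v\<in>range (r 0). (u, v) \<in> (adj G (S' - S))\<^sup>*" if "i \<le> N" for i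
  proof -
    have "Y i \<subseteq> S' - S" using that S'(2) Y(1)[of i] by auto
    then show ?thesis using Y(3)[of i] adj_rtrancl_mono[of "Y i" "S' - S" G] by blast
  qed
  then show ?thesis using S' by auto
qed

text \<open>
  The sets \<open>S k\<close> are built one after the other: given \<open>S k\<close>, finitely many
  finite paths outside \<open>S k\<close> link all rays used so far, and \<open>S (k + 1)\<close> is
  a finite down-closed set containing them and \<open>S k\<close>. It misses all but finitely many
  of the disjoint rays, so the next ray kept can be one of those beyond. Level \<open>k\<close> is
  \<open>S k - S (k - 1)\<close>; for \<open>k = 0\<close> it is empty.
\<close>

lemma levels:
  assumes equiv: "\<And>i. (r i, r 0) \<in> ray_equiv G"
  obtains N :: "nat \<Rightarrow> nat" and S :: "nat \<Rightarrow> 'a set" where "strict_mono N"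
    and "\<And>k. down_closed (S k)" "mono S"
    and "\<And>k i. k \<le> i \<Longrightarrow> range (r (N i)) \<inter> S k = {}"
    and "\<And>k i. i < k \<Longrightarrow> \<exists>u\<in>range (r (N i)) \<inter> (S k - S (k - 1)). \<exists>v\<in>range (r (N 0)).
           (u, v) \<in> (adj G (S k - S (k - 1)))\<^sup>*"
proof -
  \<comment> \<open>A state consists of the current set and the index of the ray chosen last.\<close>
  define P where "P n x \<longleftrightarrow> finite (fst x) \<and> down_closed (fst x) \<and>
     (\<forall>i\<ge>snd x. range (r i) \<inter> fst x = {}) \<and> (n = 0 \<longrightarrow> snd x = 0)" for n :: nat and x :: "'a set \<times> nat"
  define R where "R x y \<longleftrightarrow> fst x \<subseteq> fst y \<and> snd x < snd y \<and>
     (\<forall>i\<le>snd x. \<exists>u\<in>range (r i) \<inter> (fst y - fst x). \<exists>v\<in>range (r 0). (u, v) \<in> (adj G (fst y - fst x))\<^sup>*)"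
    for x y :: "'a set \<times> nat"
  have "\<exists>f. \<forall>n. P n (f n) \<and> R (f n) (f (Suc n))"
  proof (rule dependent_nat_choice)
    show "\<exists>x. P 0 x"
      by (rule exI[of _ "({}, 0)"]) (simp add: P_def down_closed_def)
  next
    fix x n assume x: "P n x"
    obtain S N where SN: "x = (S, N)" by (cases x)
    obtain S' where S': "finite S'" "down_closed S'" "S \<subseteq> S'"
      "\<forall>i\<le>N. \<exists>u\<in>range (r i) \<inter> (S' - S). \<exists>v\<in>range (r 0). (u, v) \<in> (adj G (S' - S))\<^sup>*"
      using next_level[OF equiv, of S N] x SN unfolding P_def by auto
    have "inj (\<lambda>i. r i 0)" by (auto simp: inj_def r_eq_iff)
    then have "finite ((\<lambda>i. r i 0) -` S')" by (rule finite_vimageI[OF S'(1)])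
    then obtain M where M: "\<And>i. r i 0 \<in> S' \<Longrightarrow> i < M"
      by (metis finite_nat_set_iff_bounded vimageI)
    have M': "range (r i) \<inter> S' = {}" if "i \<ge> M" for i
      using M[of i] down_closedD[OF S'(2), of i _ 0] that by fastforce
    have "P (Suc n) (S', max M (Suc N)) \<and> R x (S', max M (Suc N))"
      unfolding P_def R_def using S' M' SN by auto
    then show "\<exists>y. P (Suc n) y \<and> R x y" by blast
  qed
  then obtain f where P: "\<And>n. P n (f n)" and R: "\<And>n. R (f n) (f (Suc n))" by metis
  show ?thesis
  proof
    show mono: "strict_mono (\<lambda>n. snd (f n))"
      using R by (simp add: R_def strict_mono_Suc_iff)
    show "down_closed (fst (f k))" for k
      using P by (auto simp: P_def)
    show "mono (\<lambda>n. fst (f n))"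
      using R by (simp add: R_def mono_iff_le_Suc)
    show "range (r (snd (f i))) \<inter> fst (f k) = {}" if "k \<le> i" for i k
    proof -
      have "snd (f k) \<le> snd (f i)" using strict_mono_less_eq[OF mono] that by simp
      then show ?thesis using P[of k] by (simp add: P_def)
    qed
    show "\<exists>u\<in>range (r (snd (f i))) \<inter> (fst (f k) - fst (f (k - 1))). \<exists>v\<in>range (r (snd (f 0))).
        (u, v) \<in> (adj G (fst (f k) - fst (f (k - 1))))\<^sup>*" if "i < k" for i k
    proof -
      have "k = Suc (k - 1)" "snd (f i) \<le> snd (f (k - 1))" "snd (f 0) = 0"
        using that strict_mono_less_eq[OF mono, of i "k - 1"] P[of 0] by (auto simp: P_def)
      then show ?thesis using R[of "k - 1"] unfolding R_def by metis
    qed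
  qed
qed

definition outside :: "'a set" where
  "outside = - (\<Union>i. range (r i))"

text \<open>
  The graph obtained from \<open>D\<close> by contracting every ray: two indices are adjacent if
  their rays are joined by a path in \<open>D\<close> that avoids all other rays.
\<close>

definition ray_links :: "'a set \<Rightarrow> (nat \<times> nat) set" where
  "ray_links D = {(c, d). \<exists>u\<in>range (r c) \<inter> D. \<exists>v\<in>range (r d) \<inter> D.
     (u, v) \<in> (adj G (D \<inter> (outside \<union> range (r c) \<union> range (r d))))\<^sup>*}"

lemma sym_ray_links: "sym (ray_links D)"
proof (rule symI)
  fix c d assume "(c, d) \<in> ray_links D"
  then obtain u v where "u \<in> range (r c) \<inter> D" "v \<in> range (r d) \<inter> D"
    "(u, v) \<in> (adj G (D \<inter> (outside \<union> range (r c) \<union> range (r d))))\<^sup>*"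
    by (auto simp: ray_links_def)
  moreover have "outside \<union> range (r c) \<union> range (r d) = outside \<union> range (r d) \<union> range (r c)" by auto
  ultimately show "(d, c) \<in> ray_links D"
    unfolding ray_links_def using adj_rtrancl_sym by fastforce
qed

text \<open>
  Follow the walk and remember the last ray \<open>c\<close> that it visited, together with the
  vertex \<open>w\<close> in which it entered that ray: whenever the walk reaches some ray
  \<open>d\<close>, the part since \<open>w\<close> shows that \<open>c\<close> and \<open>d\<close>
  are adjacent.
\<close>

lemma walk_to_ray_links:
  assumes "(u, v) \<in> (adj G D)\<^sup>*" "u \<in> range (r i) \<inter> D" "v \<in> range (r j)"
  shows "(i, j) \<in> (ray_links D)\<^sup>*"
proof -
  have "\<exists>c. (i, c) \<in> (ray_links D)\<^sup>* \<and> v \<in> D \<inter> (outside \<union> range (r c)) \<and>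
     (\<exists>w\<in>range (r c) \<inter> D. (w, v) \<in> (adj G (D \<inter> (outside \<union> range (r c))))\<^sup>*)"
    using assms(1)
  proof (induction rule: rtrancl_induct)
    case base
    then show ?case using assms(2) by (intro exI[of _ i]) auto
  next
    case (step y z)
    then obtain c w where c: "(i, c) \<in> (ray_links D)\<^sup>*" "y \<in> D \<inter> (outside \<union> range (r c))"
      "w \<in> range (r c) \<inter> D" "(w, y) \<in> (adj G (D \<inter> (outside \<union> range (r c))))\<^sup>*"
      by blast
    have yz: "{y, z} \<in> edges G" "z \<in> D" using step.hyps by (auto simp: adj_def)
    show ?case
    proof (cases "z \<in> outside")
      case True
      then have "(w, z) \<in> (adj G (D \<inter> (outside \<union> range (r c))))\<^sup>*"
        using c yz by - (rule adj_rtrancl_step[OF c(4)], auto)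
      then show ?thesis using c yz True by blast
    next
      case False
      then obtain d where d: "z \<in> range (r d)" by (auto simp: outside_def)
      let ?X = "D \<inter> (outside \<union> range (r c) \<union> range (r d))"
      have "(w, y) \<in> (adj G ?X)\<^sup>*"
        using adj_rtrancl_mono[of "D \<inter> (outside \<union> range (r c))" ?X G] c(4) by blast
      then have "(w, z) \<in> (adj G ?X)\<^sup>*"
        using c yz d by - (rule adj_rtrancl_step[of w y], auto)
      then have "(c, d) \<in> ray_links D"
        unfolding ray_links_def using c(3) d yz by blast
      then have "(i, d) \<in> (ray_links D)\<^sup>*"
        using c(1) by (rule rtrancl_into_rtrancl[rotated])
      then show ?thesis using d yz by blast
    qed
  qed
  then obtain c where "(i, c) \<in> (ray_links D)\<^sup>*" "v \<in> outside \<union> range (r c)" by blast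
  moreover have "c = j"
    using calculation(2) assms(3) disjoint[of c j] by (auto simp: outside_def)
  ultimately show ?thesis by simp
qed

text \<open>
  Between the end of one link and the start of the next one the walk moves along the common ray,
  which stays inside the level because both sets are down-closed. Restricting the links to
  \<open>I\<close> keeps the walk off all rays with other indices.
\<close>

lemma ray_links_to_walk:
  assumes "(i, j) \<in> (ray_links (S' - S) \<inter> I \<times> I)\<^sup>*" "down_closed S" "down_closed S'" "i \<in> I"
    and "u \<in> range (r i) \<inter> (S' - S)" "v \<in> range (r j) \<inter> (S' - S)"
  shows "(u, v) \<in> (adj G ((S' - S) \<inter> (outside \<union> (\<Union>c\<in>I. range (r c)))))\<^sup>*"
  using assms(1,6)
proof (induction arbitrary: v rule: rtrancl_induct)
  case base
  let ?X = "range (r i) \<inter> (S' - S)"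
  have "(u, v) \<in> (adj G ?X)\<^sup>*"
    by (rule segment_linked[OF assms(2,3,5) base])
  then show ?case
    using adj_rtrancl_mono[of ?X "(S' - S) \<inter> (outside \<union> (\<Union>c\<in>I. range (r c)))" G] assms(4) by blast
next
  case (step c d)
  let ?Y = "(S' - S) \<inter> (outside \<union> (\<Union>c\<in>I. range (r c)))"
  have I: "c \<in> I" "d \<in> I" using step.hyps by auto
  obtain a b where ab: "a \<in> range (r c) \<inter> (S' - S)" "b \<in> range (r d) \<inter> (S' - S)"
    "(a, b) \<in> (adj G ((S' - S) \<inter> (outside \<union> range (r c) \<union> range (r d))))\<^sup>*"
    using step.hyps(2) by (auto simp: ray_links_def)
  have "(u, a) \<in> (adj G ?Y)\<^sup>*" by (rule step.IH[OF ab(1)])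
  also have "(a, b) \<in> (adj G ?Y)\<^sup>*"
    using ab(3) adj_rtrancl_mono[of "(S' - S) \<inter> (outside \<union> range (r c) \<union> range (r d))" ?Y G] I by blast
  also have "(b, v) \<in> (adj G (range (r d) \<inter> (S' - S)))\<^sup>*"
    by (rule segment_linked[OF assms(2,3) ab(2) step.prems])
  then have "(b, v) \<in> (adj G ?Y)\<^sup>*"
    using adj_rtrancl_mono[of "range (r d) \<inter> (S' - S)" ?Y G] I by blast
  finally show ?case .
qed

text \<open>
  The levels are disjoint, so a finite set \<open>F\<close> misses one of the infinitely many levels
  on which the Ramsey argument links the consecutive rays.
\<close>

lemma linked_subsequence:
  assumes S: "\<And>k. down_closed (S k)" "mono S"
    and apart: "\<And>k i. k \<le> i \<Longrightarrow> range (r i) \<inter> S k = {}"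
    and links: "\<And>k i. i < k \<Longrightarrow> \<exists>u\<in>range (r i) \<inter> (S k - S (k - 1)). \<exists>v\<in>range (r 0).
           (u, v) \<in> (adj G (S k - S (k - 1)))\<^sup>*"
  obtains h :: "nat \<Rightarrow> nat" where "strict_mono h"
    and "\<And>n F. finite F \<Longrightarrow> \<exists>u\<in>range (r (h n)) - F. \<exists>v\<in>range (r (h (Suc n))) - F.
      (u, v) \<in> (adj G (- F - (\<Union>m\<in>-{n, Suc n}. range (r (h m)))))\<^sup>*"
proof -
  define D where "D k = S k - S (k - 1)" for k
  obtain h :: "nat \<Rightarrow> nat" where h: "strict_mono h"
    and Q: "\<And>n k. h (Suc n) < h k \<Longrightarrow> (h n, h (Suc n)) \<in>
      (ray_links (D (h k)) \<inter> (- h ` (- {n, Suc n})) \<times> (- h ` (- {n, Suc n})))\<^sup>*"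
  proof (rule consecutive_links[of "\<lambda>k. ray_links (D k)"])
    show "sym (ray_links (D k))" for k by (rule sym_ray_links)
    show "ray_links (D k) \<subseteq> {..<k} \<times> {..<k}" for k
      using apart[of k] unfolding ray_links_def D_def by (fastforce simp: not_le[symmetric])
    show "(i, 0) \<in> (ray_links (D k))\<^sup>*" if "i < k" for i k
      using links[OF that] walk_to_ray_links[of _ _ "D k" i 0] by (auto simp: D_def)
  qed (rule that)
  have "\<exists>u\<in>range (r (h n)) - F. \<exists>v\<in>range (r (h (Suc n))) - F.
      (u, v) \<in> (adj G (- F - (\<Union>m\<in>-{n, Suc n}. range (r (h m)))))\<^sup>*" if F: "finite F" for n F
  proof -
    let ?I = "- h ` (- {n, Suc n})"
    have DD: "D k \<inter> D l = {}" if "k < l" for k l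
    proof -
      have "k \<le> l - 1" using that by simp
      then show ?thesis using monoD[OF S(2)] unfolding D_def by blast
    qed
    have "\<exists>k>Suc n. D (h k) \<inter> F = {}"
    proof (rule ccontr)
      assume "\<not> ?thesis"
      then have "D (h (k + Suc (Suc n))) \<inter> F \<noteq> {}" for k by simp
      then have "\<forall>k. \<exists>x. x \<in> D (h (k + Suc (Suc n))) \<inter> F" by blast
      then obtain g where g: "\<And>k. g k \<in> D (h (k + Suc (Suc n))) \<inter> F" by metis
      have "inj g"
      proof (rule linorder_injI)
        fix k l :: nat assume "k < l"
        then have "h (k + Suc (Suc n)) < h (l + Suc (Suc n))" using h by (simp add: strict_mono_less)
        then show "g k \<noteq> g l" using DD g[of k] g[of l] by (metis IntD1 IntI emptyE)
      qed
      moreover have "range g \<subseteq> F" using g by auto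
      ultimately show False using F finite_subset infinite_iff_countable_subset by blast
    qed
    then obtain k where k: "Suc n < k" "D (h k) \<inter> F = {}" by blast
    have lt: "h n < h k" "h (Suc n) < h k" using h k by (auto simp: strict_mono_less)
    obtain u v where uv: "u \<in> range (r (h n)) \<inter> D (h k)" "v \<in> range (r (h (Suc n))) \<inter> D (h k)"
      using links[OF lt(1)] links[OF lt(2)] unfolding D_def by blast
    have inI: "h n \<in> ?I" using h by (auto simp: strict_mono_eq)
    let ?X = "D (h k) \<inter> (outside \<union> (\<Union>c\<in>?I. range (r c)))"
    have "(u, v) \<in> (adj G ?X)\<^sup>*"
      using Q[OF lt(2)] uv S(1) inI unfolding D_def by - (rule ray_links_to_walk, auto)
    moreover have "?X \<subseteq> - F - (\<Union>m\<in>-{n, Suc n}. range (r (h m)))"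
    proof
      fix x assume x: "x \<in> ?X"
      have "x \<notin> range (r (h m))" if "m \<in> - {n, Suc n}" for m
      proof
        assume xm: "x \<in> range (r (h m))"
        then obtain c where c: "c \<in> ?I" "x \<in> range (r c)" using x by (auto simp: outside_def)
        then have "c = h m" using xm disjoint[of c "h m"] by blast
        then show False using c that by blast
      qed
      then show "x \<in> - F - (\<Union>m\<in>-{n, Suc n}. range (r (h m)))" using x k by blast
    qed
    ultimately have "(u, v) \<in> (adj G (- F - (\<Union>m\<in>-{n, Suc n}. range (r (h m)))))\<^sup>*"
      using adj_rtrancl_mono by blast
    then show ?thesis using uv k(2) by blast
  qed
  then show ?thesis by (rule that[OF h])
qed

end

section \<open>Paths and topological minors\<close>

lemma successively_path_edges:
  "successively (\<lambda>u v. {u, v} \<in> E) p \<longleftrightarrow> path_edges p \<subseteq> E"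
  by (auto simp: successively_conv_nth path_edges_def)

lemma inner_verts_Cons_snoc [simp]: "inner_verts (x # p @ [y]) = set p"
  by (simp add: inner_verts_def)

lemma path_list_Cons_snoc:
  assumes "path_list p"
  obtains q where "p = hd p # q @ [last p]"
proof -
  have "p \<noteq> []" "tl p \<noteq> []"
    using assms by (auto simp: path_list_def Suc_le_length_iff numeral_2_eq_2)
  then have "p = hd p # butlast (tl p) @ [last p]"
    by (metis append_butlast_last_id last_tl list.collapse)
  then show ?thesis by (rule that)
qed

lemma set_path_list: "path_list p \<Longrightarrow> set p = {hd p, last p} \<union> inner_verts p"
proof (erule path_list_Cons_snoc)
  fix q assume "p = hd p # q @ [last p]"
  then obtain x y where "p = x # q @ [y]" by blast
  then show "set p = {hd p, last p} \<union> inner_verts p" by auto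
qed

text \<open>
  A shortest walk from \<open>A\<close> to \<open>B\<close> within \<open>X\<close> repeats no
  vertex and meets \<open>A \<union> B\<close> only in its ends, since otherwise a part of it could
  be cut out.
\<close>

lemma linked_path:
  assumes "(u, v) \<in> (adj G X)\<^sup>*" "u \<in> A" "u \<in> X" "v \<in> B" "A \<inter> B = {}"
  obtains p where "path_list p" "hd p \<in> A" "last p \<in> B" "set p \<subseteq> X"
    "path_edges p \<subseteq> edges G" "inner_verts p \<inter> (A \<union> B) = {}"
proof -
  let ?E = "successively (\<lambda>u v. {u, v} \<in> edges G)"
  define W where "W p \<longleftrightarrow> p \<noteq> [] \<and> hd p \<in> A \<and> last p \<in> B \<and> set p \<subseteq> X \<and> ?E p" for p
  have "\<exists>p. p \<noteq> [] \<and> hd p = u \<and> last p = v \<and> set p \<subseteq> X \<and> ?E p"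
    using assms(1)
  proof (induction rule: rtrancl_induct)
    case base
    then show ?case using assms(3) by (intro exI[of _ "[u]"]) simp
  next
    case (step y z)
    then obtain p where "p \<noteq> [] \<and> hd p = u \<and> last p = y \<and> set p \<subseteq> X \<and> ?E p" by blast
    then show ?case
      using step.hyps(2) by (intro exI[of _ "p @ [z]"]) (auto simp: adj_def successively_append_iff)
  qed
  then have "\<exists>p. W p" using assms(2,4) unfolding W_def by blast
  then obtain p where W: "W p" and min: "\<And>q. W q \<Longrightarrow> length p \<le> length q"
    using ex_has_least_nat[of W _ length] by blast
  have distinct: "distinct p"
  proof (rule ccontr)
    assume "\<not> distinct p"
    then obtain xs ys zs y where p: "p = xs @ [y] @ ys @ [y] @ zs"
      using not_distinct_decomp by blast
    have "W (xs @ [y] @ zs)"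
      using W unfolding p W_def by (cases xs; cases zs) (auto simp: successively_append_iff successively_Cons hd_append split: if_splits)
    then show False using min p by fastforce
  qed
  moreover have "hd p \<noteq> last p" using W assms(5) by (auto simp: W_def)
  then have "length p \<ge> 2" using W by (cases p rule: remdups_adj.cases) (auto simp: W_def)
  ultimately have pl: "path_list p" by (simp add: path_list_def)
  then obtain q where q: "p = hd p # q @ [last p]" by (rule path_list_Cons_snoc)
  have "x \<notin> A \<union> B" if x: "x \<in> set q" for x
  proof -
    obtain q1 q2 where q12: "q = q1 @ x # q2" using split_list[OF x] by blast
    then have p: "p = hd p # q1 @ x # q2 @ [last p]" using q by simp
    have E: "?E (hd p # q1 @ x # q2 @ [last p])" using W p by (metis W_def)
    have X: "insert (hd p) (insert x (insert (last p) (set q1 \<union> set q2))) \<subseteq> X"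
    proof -
      have "set p = insert (hd p) (insert x (insert (last p) (set q1 \<union> set q2)))"
        by (subst p) auto
      then show ?thesis using W by (simp add: W_def)
    qed
    have AB: "hd p \<in> A" "last p \<in> B" using W by (auto simp: W_def)
    have l: "length p = length q1 + length q2 + 3" using arg_cong[OF p, of length] by simp
    show ?thesis
    proof
      assume "x \<in> A \<union> B"
      then show False
      proof
        assume "x \<in> A"
        then have "W (x # q2 @ [last p])"
          unfolding W_def using AB X E by (auto simp: successively_append_iff successively_Cons)
        then show False using min l by fastforce
      next
        assume "x \<in> B"
        then have "W (hd p # q1 @ [x])"
          unfolding W_def using AB X E by (auto simp: successively_append_iff successively_Cons hd_append split: if_splits)
        then show False using min l by fastforce
      qed
    qed
  qed
  then have "inner_verts p \<inter> (A \<union> B) = {}" using q by (metis disjoint_iff inner_verts_Cons_snoc)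
  then show ?thesis
    using that[OF pl] W by (auto simp: W_def successively_path_edges)
qed

lemma topological_minorI:
  assumes G: "simple_graph G" and inj: "inj_on \<phi> (verts X)" and \<phi>: "\<phi> ` verts X \<subseteq> verts G"
    and path: "\<And>e. e \<in> edges X \<Longrightarrow> path_list (P e)"
    and ends: "\<And>e. e \<in> edges X \<Longrightarrow> {hd (P e), last (P e)} = \<phi> ` e"
    and inner: "\<And>e. e \<in> edges X \<Longrightarrow> inner_verts (P e) \<inter> \<phi> ` verts X = {}"
    and disj: "\<And>e f. e \<in> edges X \<Longrightarrow> f \<in> edges X \<Longrightarrow> e \<noteq> f \<Longrightarrow> inner_verts (P e) \<inter> inner_verts (P f) = {}"
    and sub: "\<And>e. e \<in> edges X \<Longrightarrow> path_edges (P e) \<subseteq> edges G"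
  shows "topological_minor X G"
proof -
  let ?H = "\<lparr>verts = \<phi> ` verts X \<union> (\<Union>e\<in>edges X. set (P e)), edges = (\<Union>e\<in>edges X. path_edges (P e))\<rparr>"
  have "subdivision_of X ?H"
    unfolding subdivision_of_def using assms by (intro exI[of _ \<phi>] exI[of _ P]) simp
  moreover have "simple_graph ?H"
    unfolding simple_graph_def
  proof
    fix f assume "f \<in> edges ?H"
    then obtain e i where e: "e \<in> edges X" "f = {P e ! i, P e ! Suc i}" "Suc i < length (P e)"
      by (auto simp: path_edges_def)
    then have "P e ! i \<noteq> P e ! Suc i"
      using path[OF e(1)] by (simp add: path_list_def nth_eq_iff_index_eq)
    moreover have "f \<subseteq> set (P e)" using e by simp
    then have "f \<subseteq> verts ?H" using e(1) by auto
    ultimately show "f \<subseteq> verts ?H \<and> card f = 2" using e by simp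
  qed
  moreover have "set (P e) \<subseteq> verts G" if "e \<in> edges X" for e
  proof
    fix x assume "x \<in> set (P e)"
    then obtain i where i: "i < length (P e)" "x = P e ! i" by (auto simp: in_set_conv_nth)
    have "2 \<le> length (P e)" using path[OF that] by (simp add: path_list_def)
    then have "\<exists>f\<in>path_edges (P e). x \<in> f"
    proof (cases "Suc i < length (P e)")
      case True
      then show ?thesis using i by (auto simp: path_edges_def)
    next
      case False
      then have "i = Suc (i - 1)" using i \<open>2 \<le> length (P e)\<close> by simp
      then have "{P e ! (i - 1), x} \<in> path_edges (P e)" using i unfolding path_edges_def by force
      then show ?thesis by blast
    qed
    then show "x \<in> verts G" using sub[OF that] G by (auto simp: simple_graph_def)
  qed
  moreover have "(\<Union>e\<in>edges X. path_edges (P e)) \<subseteq> edges G"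
    using sub by (rule UN_least)
  ultimately have "subgraph ?H G"
    using \<phi> unfolding subgraph_def by auto
  then show ?thesis using \<open>subdivision_of X ?H\<close> by (auto simp: topological_minor_def)
qed

section \<open>The hexagonal quarter grid\<close>

lemma verts_hex: "verts hex_quarter_grid = {(n, m). n \<le> m \<and> 0 < m}"
  by (auto simp: hex_quarter_grid_def delete_edges_def delete_verts_def nat_grid_def)

lemma edges_hex:
  "edges hex_quarter_grid =
     {{(n, m), (n, Suc m)} | n m. n \<le> m \<and> 0 < m} \<union>
     {{(n, m), (Suc n, m)} | n m. n < m \<and> odd (n + m)}" (is "?E = ?V \<union> ?H")
proof
  show "?E \<subseteq> ?V \<union> ?H"
  proof
    fix e assume "e \<in> ?E"
    then have e: "e \<in> edges nat_grid" "e \<inter> ({(0, 0)} \<union> {(n, m). n > m}) = {}"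
      "e \<notin> {{(n, m), (n + 1, m)} | n m. even n \<longleftrightarrow> even m}"
      by (simp_all add: hex_quarter_grid_def delete_edges_def delete_verts_def)
    obtain n m n' m' where nm: "e = {(n, m), (n', m')}" "\<bar>int n - int n'\<bar> + \<bar>int m - int m'\<bar> = 1"
      using e(1) unfolding nat_grid_def by auto
    then consider "n' = n" "m' = Suc m" | "n' = n" "m = Suc m'" | "n' = Suc n" "m' = m" | "n = Suc n'" "m' = m"
      by linarith
    then show "e \<in> ?V \<union> ?H"
    proof cases
      case 1
      then have "e = {(n, m), (n, Suc m)}" "n \<le> m" "0 < m" using nm e(2) by (auto simp: not_less)
      then show ?thesis by blast
    next
      case 2
      then have "e = {(n, m'), (n, Suc m')}" "n \<le> m'" "0 < m'" using nm e(2) by (auto simp: not_less)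
      then show ?thesis by blast
    next
      case 3
      then have "e = {(n, m), (Suc n, m)}" "n < m" using nm e(2) by (auto simp: not_less)
      moreover from this have "odd (n + m)" using e(3) by (auto)
      ultimately show ?thesis by blast
    next
      case 4
      then have "e = {(n', m), (Suc n', m)}" "n' < m" using nm e(2) by (auto simp: not_less)
      moreover from this have "odd (n' + m)" using e(3) by (auto)
      ultimately show ?thesis by blast
    qed
  qed
  have nat: "{(n, m), (n', m')} \<in> edges nat_grid" if "\<bar>int n - int n'\<bar> + \<bar>int m - int m'\<bar> = 1" for n m n' m'
    using that unfolding nat_grid_def by auto
  have "{(n, m), (n, Suc m)} \<in> ?E" if "n \<le> m" "0 < m" for n m
    using nat[of n n m "Suc m"] that
    by (auto simp: hex_quarter_grid_def delete_edges_def delete_verts_def doubleton_eq_iff)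
  moreover have "{(n, m), (Suc n, m)} \<in> ?E" if "n < m" "odd (n + m)" for n m
    using nat[of n "Suc n" m m] that
    by (auto simp: hex_quarter_grid_def delete_edges_def delete_verts_def doubleton_eq_iff)
  ultimately show "?V \<union> ?H \<subseteq> ?E" by blast
qed

section \<open>Choosing the rungs\<close>

text \<open>
  The pair \<open>(n, m)\<close> with \<open>n < m\<close> stands for the rung that joins columns
  \<open>n\<close> and \<open>n + 1\<close> in row \<open>m\<close>. Rungs are chosen row by row, so
  that each has only finitely many predecessors.
\<close>

definition row_order :: "((nat \<times> nat) \<times> (nat \<times> nat)) set" where
  "row_order = {((n, m), (n', m')). n < m \<and> n' < m' \<and> (m < m' \<or> m = m' \<and> n < n')}"

lemma wf_row_order: "wf row_order"
proof (rule wf_subset)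
  show "wf (inv_image (less_than <*lex*> less_than) (\<lambda>(n :: nat, m :: nat). (m, n)))" by auto
qed (auto simp: row_order_def)

lemma finite_row_order: "finite {y. (y, x) \<in> row_order}"
proof (rule finite_subset)
  show "{y. (y, x) \<in> row_order} \<subseteq> {..snd x} \<times> {..snd x}" by (auto simp: row_order_def)
qed simp

context ray_family
begin

text \<open>
  Every new rung avoids the finite set that consists of the earlier rungs and, on each ray that they
  meet, of everything up to one step above the vertices in which they meet it. The extra step leaves
  a spare vertex on each ray between consecutive rungs. It is needed on the first column, half of
  whose branch vertices are not incident with a rung.
\<close>

lemma rung_system:
  assumes link: "\<And>n F. finite F \<Longrightarrow> \<exists>u\<in>range (r n) - F. \<exists>v\<in>range (r (Suc n)) - F.
      (u, v) \<in> (adj G (- F - (\<Union>m\<in>-{n, Suc n}. range (r m))))\<^sup>*"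
  obtains p where
    "\<And>n m. n < m \<Longrightarrow> path_list (p (n, m)) \<and> hd (p (n, m)) \<in> range (r n) \<and> last (p (n, m)) \<in> range (r (Suc n)) \<and>
        path_edges (p (n, m)) \<subseteq> edges G \<and> (\<forall>i. inner_verts (p (n, m)) \<inter> range (r i) = {})"
    "\<And>x y. (x, y) \<in> row_order \<Longrightarrow> set (p x) \<inter> set (p y) = {}"
    "\<And>x y i k l. (x, y) \<in> row_order \<Longrightarrow> r i k \<in> set (p x) \<Longrightarrow> r i l \<in> set (p y) \<Longrightarrow> Suc k < l"
proof -
  define used where "used f x = (\<Union>y\<in>{y. (y, x) \<in> row_order}. set (f y) \<union>
      (\<Union>(i, k)\<in>{(i, k). r i k \<in> set (f y)}. r i ` {..Suc k}))" for f :: "nat \<times> nat \<Rightarrow> 'a list" and x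
  have fin: "finite (used f x)" for f x
    unfolding used_def using finite_row_order finite_ray_indices by auto
  define P where "P f x p \<longleftrightarrow> path_list p \<and> hd p \<in> range (r (fst x)) \<and> last p \<in> range (r (Suc (fst x))) \<and>
        path_edges p \<subseteq> edges G \<and> (\<forall>i. inner_verts p \<inter> range (r i) = {}) \<and> set p \<inter> used f x = {}" for f x p
  have "\<exists>f. \<forall>x. P f x (f x)"
  proof (rule dependent_wf_choice[OF wf_row_order])
    fix f g :: "nat \<times> nat \<Rightarrow> 'a list" and x q
    assume "\<And>z. (z, x) \<in> row_order \<Longrightarrow> f z = g z"
    then have "used f x = used g x" unfolding used_def by auto
    then show "P f x q = P g x q" by (simp add: P_def)
  next
    fix x :: "nat \<times> nat" and f :: "nat \<times> nat \<Rightarrow> 'a list"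
    obtain n m where x: "x = (n, m)" by (cases x)
    let ?X = "- used f x - (\<Union>m\<in>-{n, Suc n}. range (r m))"
    obtain u v where uv: "u \<in> range (r n) - used f x" "v \<in> range (r (Suc n)) - used f x" "(u, v) \<in> (adj G ?X)\<^sup>*"
      using link[OF fin] by blast
    have dis: "range (r n) \<inter> range (r (Suc n)) = {}" by (rule disjoint) simp
    have "u \<notin> range (r i)" if "i \<in> - {n, Suc n}" for i
      using uv(1) disjoint[of n i] that by auto
    then have "u \<in> ?X" using uv(1) by blast
    then obtain p where p: "path_list p" "hd p \<in> range (r n)" "last p \<in> range (r (Suc n))" "set p \<subseteq> ?X"
      "path_edges p \<subseteq> edges G" "inner_verts p \<inter> (range (r n) \<union> range (r (Suc n))) = {}"
      using linked_path[OF uv(3) _ _ _ dis] uv(1,2) by blast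
    have "inner_verts p \<subseteq> set p" using set_path_list[OF p(1)] by blast
    then have "inner_verts p \<inter> range (r i) = {}" for i
      using p(4,6) by (cases "i \<in> {n, Suc n}") blast+
    then have "P f x p" using p x by (auto simp: P_def)
    then show "\<exists>p. P f x p" ..
  qed
  then obtain p where p: "\<And>x. P p x (p x)" by blast
  show ?thesis
  proof
    fix n m :: nat
    show "path_list (p (n, m)) \<and> hd (p (n, m)) \<in> range (r n) \<and> last (p (n, m)) \<in> range (r (Suc n)) \<and>
        path_edges (p (n, m)) \<subseteq> edges G \<and> (\<forall>i. inner_verts (p (n, m)) \<inter> range (r i) = {})"
      using p[of "(n, m)"] by (simp add: P_def)
  next
    fix x y assume xy: "(x, y) \<in> row_order"
    then have "set (p x) \<subseteq> used p y" by (auto simp: used_def)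
    then show "set (p x) \<inter> set (p y) = {}" using p[of y] unfolding P_def by blast
    fix i k l assume "r i k \<in> set (p x)" "r i l \<in> set (p y)"
    then have "r i ` {..Suc k} \<subseteq> used p y" using xy by (auto simp: used_def)
    moreover have "r i l \<notin> used p y" using p[of y] \<open>r i l \<in> set (p y)\<close> unfolding P_def by blast
    ultimately show "Suc k < l" by (meson atMost_iff image_eqI not_less subsetD)
  qed
qed

end

section \<open>Assembling the subdivided grid\<close>

locale rungs = ray_family G r for G :: "'a graph" and r +
  fixes p :: "nat \<times> nat \<Rightarrow> 'a list" and a b :: "nat \<Rightarrow> nat \<Rightarrow> nat"
  assumes rung_path: "n < m \<Longrightarrow> path_list (p (n, m))"
    and rung_hd: "n < m \<Longrightarrow> hd (p (n, m)) = r n (a n m)"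
    and rung_last: "n < m \<Longrightarrow> last (p (n, m)) = r (Suc n) (b n m)"
    and rung_edges: "n < m \<Longrightarrow> path_edges (p (n, m)) \<subseteq> edges G"
    and off_rays: "n < m \<Longrightarrow> inner_verts (p (n, m)) \<inter> range (r i) = {}"
    and apart: "(x, y) \<in> row_order \<Longrightarrow> set (p x) \<inter> set (p y) = {}"
    and higher: "(x, y) \<in> row_order \<Longrightarrow> r i k \<in> set (p x) \<Longrightarrow> r i l \<in> set (p y) \<Longrightarrow> Suc k < l"
begin

text \<open>
  Column \<open>n\<close> is a tail of the ray \<open>r n\<close>, and \<open>ht n m\<close> is the
  position on it of the branch vertex for \<open>(n, m)\<close>. If \<open>n + m\<close> is odd,
  then \<open>(n, m)\<close> is the left end of a rung; otherwise it is the right end of one if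
  \<open>n > 0\<close>, and for \<open>n = 0\<close> it is incident with no rung and takes the spare
  vertex just above the preceding rung.
\<close>

definition ht :: "nat \<Rightarrow> nat \<Rightarrow> nat" where
  "ht n m = (if odd (n + m) then a n m else if n = 0 then Suc (a 0 (m - 1)) else b (n - 1) m)"

definition branch :: "nat \<times> nat \<Rightarrow> 'a" where
  "branch = (\<lambda>(n, m). r n (ht n m))"

definition segment :: "nat \<Rightarrow> nat \<Rightarrow> 'a list" where
  "segment n m = map (r n) [ht n m..<Suc (ht n (Suc m))]"

text \<open>
  The edge is decoded from its least coordinates: it is vertical if its first coordinates agree.
\<close>

definition edge_path :: "(nat \<times> nat) set \<Rightarrow> 'a list" where
  "edge_path e = (let n = Min (fst ` e); m = Min (snd ` e) in if fst ` e = {n} then segment n m else p (n, m))"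

lemma in_path:
  assumes "n < m"
  shows "r n (a n m) \<in> set (p (n, m))" "r (Suc n) (b n m) \<in> set (p (n, m))"
  using set_path_list[OF rung_path[OF assms]] rung_hd[OF assms] rung_last[OF assms] by auto

text \<open>
  Of two branch vertices in consecutive rows of a column, the upper one lies on a rung that was
  chosen later, or is the spare vertex above the rung of the lower one. If the lower one is itself a
  spare vertex, one step above its rung, the next rung still ends higher, as rungs keep a distance
  of two.
\<close>

lemma ht_Suc:
  assumes nm: "n \<le> m" "0 < m"
  shows "ht n m < ht n (Suc m)"
proof (cases "odd (n + m)")
  case True
  then have "n < m" using nm(1) by (cases "n = m") auto
  show ?thesis
  proof (cases n)
    case 0
    then show ?thesis using True by (simp add: ht_def)
  next
    case (Suc k)
    have "((n, m), (k, Suc m)) \<in> row_order" using Suc \<open>n < m\<close> by (simp add: row_order_def)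
    moreover have "k < Suc m" using Suc nm by simp
    ultimately have "Suc (a n m) < b k (Suc m)"
      using in_path(1)[OF \<open>n < m\<close>] in_path(2)[of k "Suc m"] Suc by (blast intro: higher)
    then show ?thesis using Suc True by (simp add: ht_def)
  qed
next
  case False
  show ?thesis
  proof (cases n)
    case 0
    then obtain l where l: "m = Suc l" "0 < l" using nm False by (cases m) (auto intro: gr0I)
    have "((0, l), (0, Suc m)) \<in> row_order" using l by (simp add: row_order_def)
    then have "Suc (a 0 l) < a 0 (Suc m)"
      using in_path(1)[OF l(2)] in_path(1)[of 0 "Suc m"] by (blast intro: higher)
    then show ?thesis using 0 l False by (simp add: ht_def)
  next
    case (Suc k)
    have "k < m" "n < Suc m" using Suc nm by auto
    moreover have "((k, m), (n, Suc m)) \<in> row_order" using Suc nm by (simp add: row_order_def)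
    ultimately have "Suc (b k m) < a n (Suc m)"
      using in_path(2)[of k m] in_path(1)[of n "Suc m"] Suc by (blast intro: higher)
    then show ?thesis using Suc False by (simp add: ht_def)
  qed
qed

lemma ht_less:
  assumes "n \<le> m" "0 < m" "m < m'"
  shows "ht n m < ht n m'"
proof -
  have "Suc m \<le> m'" using assms(3) by simp
  then show ?thesis
  proof (induction m' rule: dec_induct)
    case base
    then show ?case using ht_Suc assms by simp
  next
    case (step k)
    then show ?case using ht_Suc[of n k] assms by simp
  qed
qed

lemma segment_eq:
  assumes "n \<le> m" "0 < m"
  shows "segment n m = r n (ht n m) # map (r n) [Suc (ht n m)..<ht n (Suc m)] @ [r n (ht n (Suc m))]"
  using ht_Suc[OF assms] by (simp add: segment_def upt_conv_Cons)

lemma segment_path: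
  assumes "n \<le> m" "0 < m"
  shows "path_list (segment n m)" "hd (segment n m) = branch (n, m)" "last (segment n m) = branch (n, Suc m)"
    and "inner_verts (segment n m) = r n ` {ht n m<..<ht n (Suc m)}"
    and "path_edges (segment n m) \<subseteq> edges G"
proof -
  have "inj_on (r n) A" for A by (simp add: inj_on_def r_eq_iff)
  moreover have "2 \<le> Suc (ht n (Suc m)) - ht n m" using ht_Suc[OF assms] by linarith
  ultimately show "path_list (segment n m)"
    by (simp add: path_list_def segment_def distinct_map del: upt_Suc)
  show "hd (segment n m) = branch (n, m)" "last (segment n m) = branch (n, Suc m)"
    by (simp_all add: segment_eq[OF assms] branch_def)
  show "inner_verts (segment n m) = r n ` {ht n m<..<ht n (Suc m)}"
    unfolding segment_eq[OF assms] inner_verts_Cons_snoc by (auto simp: atLeastSucLessThan_greaterThanLessThan)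
  show "path_edges (segment n m) \<subseteq> edges G"
    using rays[of n] by (auto simp: path_edges_def segment_def rays_def simp del: upt_Suc)
qed

lemma rung_ends:
  assumes "n < m" "odd (n + m)"
  shows "hd (p (n, m)) = branch (n, m)" "last (p (n, m)) = branch (Suc n, m)"
  using rung_hd[OF assms(1)] rung_last[OF assms(1)] assms(2) by (simp_all add: branch_def ht_def)

lemma edge_path_vertical: "edge_path {(n, m), (n, Suc m)} = segment n m"
  by (simp add: edge_path_def)

lemma edge_path_horizontal: "edge_path {(n, m), (Suc n, m)} = p (n, m)"
  by (simp add: edge_path_def)

lemma rungs_apart:
  assumes "n < m" "n' < m'" "(n, m) \<noteq> (n', m')"
  shows "set (p (n, m)) \<inter> set (p (n', m')) = {}"
proof -
  have "((n, m), (n', m')) \<in> row_order \<or> ((n', m'), (n, m)) \<in> row_order"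
    using assms by (auto simp: row_order_def)
  then show ?thesis using apart by blast
qed

lemma inner_segment_avoids_branch:
  assumes "n \<le> m" "0 < m" "n' \<le> m'" "0 < m'"
  shows "branch (n', m') \<notin> inner_verts (segment n m)"
proof
  assume "branch (n', m') \<in> inner_verts (segment n m)"
  then have n: "n' = n" and l: "ht n m < ht n m'" "ht n m' < ht n (Suc m)"
    by (auto simp: segment_path(4)[OF assms(1,2)] branch_def r_eq_iff)
  consider "m' < m" | "m' = m" | "m' = Suc m" | "Suc m < m'" by linarith
  then show False
    using l ht_less[of n m' m] ht_less[of n "Suc m" m'] assms n by cases auto
qed

lemma inner_segments_disjoint:
  assumes "n \<le> m" "0 < m" "n' \<le> m'" "0 < m'" "(n, m) \<noteq> (n', m')"
  shows "inner_verts (segment n m) \<inter> inner_verts (segment n' m') = {}"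
proof (cases "n = n'")
  case False
  then show ?thesis
    by (auto simp: segment_path(4)[OF assms(1,2)] segment_path(4)[OF assms(3,4)] r_eq_iff)
next
  case True
  have le: "ht n (Suc k) \<le> ht n l" if "n \<le> k" "0 < k" "k < l" for k l
    using that ht_less[of n "Suc k" l] by (cases "l = Suc k") auto
  have "m < m' \<or> m' < m" using assms(5) True by auto
  then have "ht n (Suc m) \<le> ht n m' \<or> ht n (Suc m') \<le> ht n m"
    using le[of m m'] le[of m' m] assms True by auto
  moreover have "inner_verts (segment n' m') = r n ` {ht n m'<..<ht n (Suc m')}"
    using segment_path(4)[OF assms(3,4)] True by simp
  ultimately show ?thesis
    unfolding segment_path(4)[OF assms(1,2)] by (auto simp: r_eq_iff)
qed

lemma inner_rung_off_segment: "n < m \<Longrightarrow> n' \<le> m' \<Longrightarrow> 0 < m' \<Longrightarrow>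
    inner_verts (p (n, m)) \<inter> inner_verts (segment n' m') = {}"
  using off_rays[of n m n'] by (auto simp: segment_path(4))

theorem hex_minor: "topological_minor hex_quarter_grid G"
proof (rule topological_minorI[where \<phi> = branch and P = edge_path])
  show "simple_graph G" by (rule simple)
  show "inj_on branch (verts hex_quarter_grid)"
  proof (rule inj_onI)
    fix x y assume x: "x \<in> verts hex_quarter_grid" and y: "y \<in> verts hex_quarter_grid" and eq: "branch x = branch y"
    obtain n m n' m' where xy: "x = (n, m)" "y = (n', m')" by (cases x, cases y)
    have "n = n'" "ht n m = ht n m'" using eq xy by (auto simp: branch_def r_eq_iff)
    moreover have "m = m'"
      using calculation ht_less[of n m m'] ht_less[of n m' m] x y xy by (force simp: verts_hex intro: linorder_neqE_nat)
    ultimately show "x = y" using xy by simp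
  qed
  show "branch ` verts hex_quarter_grid \<subseteq> verts G"
    using rays by (auto simp: branch_def rays_def)
next
  fix e assume "e \<in> edges hex_quarter_grid"
  then consider n m where "e = {(n, m), (n, Suc m)}" "n \<le> m" "0 < m"
    | n m where "e = {(n, m), (Suc n, m)}" "n < m" "odd (n + m)"
    unfolding edges_hex by blast
  note cases = this
  show "path_list (edge_path e)"
    using cases by cases (simp_all add: edge_path_vertical edge_path_horizontal segment_path rung_path)
  show "{hd (edge_path e), last (edge_path e)} = branch ` e"
    using cases by cases (simp_all add: edge_path_vertical edge_path_horizontal segment_path rung_ends)
  show "path_edges (edge_path e) \<subseteq> edges G"
    using cases by cases (simp_all add: edge_path_vertical edge_path_horizontal segment_path rung_edges)
  show "inner_verts (edge_path e) \<inter> branch ` verts hex_quarter_grid = {}"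
    using cases
  proof cases
    case (1 n m)
    then show ?thesis
      using inner_segment_avoids_branch[of n m] by (auto simp: edge_path_vertical verts_hex)
  next
    case (2 n m)
    then show ?thesis
      using off_rays[of n m] by (auto simp: edge_path_horizontal branch_def)
  qed
  fix f assume "f \<in> edges hex_quarter_grid" and ef: "e \<noteq> f"
  then consider n m where "f = {(n, m), (n, Suc m)}" "n \<le> m" "0 < m"
    | n m where "f = {(n, m), (Suc n, m)}" "n < m" "odd (n + m)"
    unfolding edges_hex by blast
  note cases' = this
  show "inner_verts (edge_path e) \<inter> inner_verts (edge_path f) = {}"
    using cases
  proof cases
    case (1 n m)
    note e = 1
    show ?thesis using cases'
    proof cases
      case (1 n' m')
      then show ?thesis
        using e ef inner_segments_disjoint[of n m n' m'] by (auto simp: edge_path_vertical)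
    next
      case (2 n' m')
      then show ?thesis
        using e inner_rung_off_segment[of n' m' n m] by (simp add: edge_path_vertical edge_path_horizontal Int_commute)
    qed
  next
    case (2 n m)
    note e = 2
    show ?thesis using cases'
    proof cases
      case (1 n' m')
      then show ?thesis
        using e inner_rung_off_segment[of n m n' m'] by (simp add: edge_path_vertical edge_path_horizontal)
    next
      case (2 n' m')
      then have "set (p (n, m)) \<inter> set (p (n', m')) = {}"
        using e ef by (intro rungs_apart) auto
      then show ?thesis
        using e 2 set_path_list[OF rung_path] by (fastforce simp: edge_path_horizontal)
    qed
  qed
qed

end

context ray_family
begin

lemma hex_minor_if_linked:
  assumes link: "\<And>n F. finite F \<Longrightarrow> \<exists>u\<in>range (r n) - F. \<exists>v\<in>range (r (Suc n)) - F.
      (u, v) \<in> (adj G (- F - (\<Union>m\<in>-{n, Suc n}. range (r m))))\<^sup>*"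
  shows "topological_minor hex_quarter_grid G"
proof -
  obtain p where p:
    "\<And>n m. n < m \<Longrightarrow> path_list (p (n, m)) \<and> hd (p (n, m)) \<in> range (r n) \<and> last (p (n, m)) \<in> range (r (Suc n)) \<and>
        path_edges (p (n, m)) \<subseteq> edges G \<and> (\<forall>i. inner_verts (p (n, m)) \<inter> range (r i) = {})"
    "\<And>x y. (x, y) \<in> row_order \<Longrightarrow> set (p x) \<inter> set (p y) = {}"
    "\<And>x y i k l. (x, y) \<in> row_order \<Longrightarrow> r i k \<in> set (p x) \<Longrightarrow> r i l \<in> set (p y) \<Longrightarrow> Suc k < l"
    by (rule rung_system, erule link) (rule that)
  have "\<forall>n m. \<exists>k. n < m \<longrightarrow> hd (p (n, m)) = r n k" "\<forall>n m. \<exists>k. n < m \<longrightarrow> last (p (n, m)) = r (Suc n) k"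
    using p(1) by blast+
  then obtain a b where ab: "\<And>n m. n < m \<Longrightarrow> hd (p (n, m)) = r n (a n m)"
    "\<And>n m. n < m \<Longrightarrow> last (p (n, m)) = r (Suc n) (b n m)"
    by metis
  interpret rungs G r p a b
  proof
    fix n m :: nat assume nm: "n < m"
    show "path_list (p (n, m))" "path_edges (p (n, m)) \<subseteq> edges G"
      "inner_verts (p (n, m)) \<inter> range (r i) = {}" for i
      using p(1)[OF nm] by simp_all
    show "hd (p (n, m)) = r n (a n m)" "last (p (n, m)) = r (Suc n) (b n m)"
      by (rule ab[OF nm])+
  qed (rule p(2,3); assumption)+
  show ?thesis by (rule hex_minor)
qed

end

lemma ray_family_subsequence:
  "ray_family G r \<Longrightarrow> strict_mono N \<Longrightarrow> ray_family G (\<lambda>i. r (N i))"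
  unfolding ray_family_def by (simp add: strict_mono_eq)

text \<open>
  The family of rays is thinned out twice: first to a family with levels, then, by the Ramsey
  argument, to one in which consecutive rays are linked.
\<close>

theorem thick_end_hex_minor:
  assumes G: "simple_graph G" and \<omega>: "\<omega> \<in> ends G" "thick \<omega>"
  shows "topological_minor hex_quarter_grid G"
proof -
  obtain R where R: "R \<subseteq> \<omega>" "infinite R" "pairwise (\<lambda>x y. disjnt (range x) (range y)) R"
    using \<omega>(2) by (auto simp: thick_def)
  obtain r :: "nat \<Rightarrow> nat \<Rightarrow> 'a" where r: "inj r" "range r \<subseteq> R"
    using infinite_countable_subset[OF R(2)] by blast
  have equiv: "(r i, r j) \<in> ray_equiv G" for i j
    using \<omega>(1) r(2) R(1) unfolding ends_def
    by (intro in_quotient_imp_in_rel[OF equiv_ray_equiv]) auto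
  have fam: "ray_family G r"
  proof
    show "r i \<in> rays G" for i using equiv[of i i] by (simp add: ray_equiv_def)
    show "range (r i) \<inter> range (r j) = {}" if "i \<noteq> j" for i j
    proof -
      have "r i \<in> R" "r j \<in> R" "r i \<noteq> r j" using r that by (auto simp: inj_eq)
      then show ?thesis using R(3) by (simp add: pairwise_def disjnt_def)
    qed
  qed (rule G)
  show ?thesis
  proof (rule ray_family.levels[OF fam equiv])
    fix N :: "nat \<Rightarrow> nat" and S :: "nat \<Rightarrow> 'a set"
    assume N: "strict_mono N" and S: "\<And>k. ray_family.down_closed r (S k)" "mono S"
      and apart: "\<And>k i. k \<le> i \<Longrightarrow> range (r (N i)) \<inter> S k = {}"
      and links: "\<And>k i. i < k \<Longrightarrow> \<exists>u\<in>range (r (N i)) \<inter> (S k - S (k - 1)). \<exists>v\<in>range (r (N 0)).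
           (u, v) \<in> (adj G (S k - S (k - 1)))\<^sup>*"
    have fam': "ray_family G (\<lambda>i. r (N i))" by (rule ray_family_subsequence[OF fam N])
    have closed': "ray_family.down_closed (\<lambda>i. r (N i)) (S k)" for k
      using S(1) by (simp add: ray_family.down_closed_def[OF fam] ray_family.down_closed_def[OF fam'])
    show ?thesis
    proof (rule ray_family.linked_subsequence[OF fam' closed' S(2)])
      fix h :: "nat \<Rightarrow> nat"
      assume h: "strict_mono h"
        and link: "\<And>n F. finite F \<Longrightarrow> \<exists>u\<in>range (r (N (h n))) - F. \<exists>v\<in>range (r (N (h (Suc n)))) - F.
          (u, v) \<in> (adj G (- F - (\<Union>m\<in>-{n, Suc n}. range (r (N (h m))))))\<^sup>*"
      have "ray_family G (\<lambda>i. r (N (h i)))" by (rule ray_family_subsequence[OF fam' h])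
      then show ?thesis by (rule ray_family.hex_minor_if_linked) (erule link)
    qed (erule apart, erule links)
  qed
qed

section \<open>From the grid to a thick end\<close>

text \<open>
  Infinitely many finite paths that are joined end to end form a ray: as every list is nonempty, the
  entry at position \<open>t\<close> of the infinite concatenation already occurs in the
  concatenation of the first \<open>t + 1\<close> lists.
\<close>

lemma spliced_ray:
  fixes L :: "nat \<Rightarrow> 'a list"
  assumes G: "simple_graph G"
    and ne: "\<And>k. L k \<noteq> []" and dist: "\<And>k. distinct (L k)"
    and disj: "\<And>j k. j < k \<Longrightarrow> set (L j) \<inter> set (L k) = {}"
    and path: "\<And>k. path_edges (L k) \<subseteq> edges G"
    and join: "\<And>k. {last (L k), hd (L (Suc k))} \<in> edges G"
  obtains x where "x \<in> rays G" "range x = (\<Union>k. set (L k))"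
proof
  define c where "c M = concat (map L [0..<M])" for M
  define x where "x t = c (Suc t) ! t" for t
  have c_Suc: "c (Suc M) = c M @ L M" and c_0: "c 0 = []" for M
    by (simp_all add: c_def)
  have len: "M \<le> length (c M)" for M
  proof (induction M)
    case (Suc M)
    then show ?case using ne[of M] by (cases "L M") (simp_all add: c_Suc)
  qed simp
  have prefix: "\<exists>zs. c (M + k) = c M @ zs" for M k
    by (induction k) (auto simp: c_Suc)
  have x_nth: "x t = c M ! t" if "t < length (c M)" for t M
  proof -
    have t: "t < length (c (Suc t))" using len[of "Suc t"] by simp
    obtain ys where ys: "c (M + Suc t) = c M @ ys" using prefix by blast
    obtain zs where "c (Suc t + M) = c (Suc t) @ zs" using prefix by blast
    then have "c M @ ys = c (Suc t) @ zs" using ys by (simp add: add.commute)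
    then show ?thesis unfolding x_def using t that by (metis nth_append)
  qed
  have set_c: "set (c M) = (\<Union>k<M. set (L k))" for M
    by (induction M) (auto simp: c_Suc c_0 lessThan_Suc)
  have distinct: "distinct (c M)" for M
  proof (induction M)
    case (Suc M)
    then show ?case using dist disj by (fastforce simp: c_Suc set_c)
  qed (simp add: c_0)
  have "successively (\<lambda>u v. {u, v} \<in> edges G) (c M)" for M
  proof (induction M)
    case (Suc M)
    have "c M = [] \<or> last (c M) = last (L (M - 1)) \<and> M \<noteq> 0"
      using ne by (cases M) (simp_all add: c_Suc c_0)
    then show ?case
      using Suc path[of M, folded successively_path_edges] join[of "M - 1"]
      by (auto simp: c_Suc successively_append_iff)
  qed (simp add: c_0)
  then have "{x t, x (Suc t)} \<in> edges G" for t
    using len[of "Suc (Suc t)"] x_nth[of t "Suc (Suc t)"] x_nth[of "Suc t" "Suc (Suc t)"]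
      successively_nth[of "\<lambda>u v. {u, v} \<in> edges G" "c (Suc (Suc t))" t] by simp
  moreover have "inj x"
  proof (rule injI)
    fix s t assume "x s = x t"
    moreover have "s < length (c (Suc (max s t)))" "t < length (c (Suc (max s t)))"
      using len[of "Suc (max s t)"] by auto
    ultimately show "s = t"
      using x_nth distinct by (metis nth_eq_iff_index_eq)
  qed
  moreover have "x t \<in> verts G" for t
    using G calculation(1)[of t] by (auto simp: simple_graph_def)
  ultimately show "x \<in> rays G"
    by (auto simp: rays_def)
  show "range x = (\<Union>k. set (L k))"
  proof
    have "x t \<in> set (c (Suc t))" for t using len[of "Suc t"] by (simp add: x_def)
    then show "range x \<subseteq> (\<Union>k. set (L k))" by (auto simp: set_c)
    show "(\<Union>k. set (L k)) \<subseteq> range x"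
    proof
      fix y assume "y \<in> (\<Union>k. set (L k))"
      then obtain k where "y \<in> set (c (Suc k))" by (auto simp: c_Suc)
      then obtain t where "t < length (c (Suc k))" "y = c (Suc k) ! t" by (auto simp: in_set_conv_nth)
      then show "y \<in> range x" using x_nth[of t "Suc k"] by (metis rangeI)
    qed
  qed
qed

lemma path_edges_rev: "path_edges (rev p) = path_edges p"
proof -
  have "path_edges (rev p) \<subseteq> E \<longleftrightarrow> path_edges p \<subseteq> E" for E
    by (simp add: successively_path_edges[symmetric] insert_commute)
  then show ?thesis by blast
qed

lemma path_linked:
  "p \<noteq> [] \<Longrightarrow> path_edges p \<subseteq> edges G \<Longrightarrow> (hd p, last p) \<in> (adj G (set p))\<^sup>*"
proof (induction p rule: list_nonempty_induct)
  case (cons x xs)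
  have *: "{x, hd xs} \<in> edges G" "path_edges xs \<subseteq> edges G"
    using cons.prems cons.hyps unfolding successively_path_edges[symmetric] by (auto simp: successively_Cons)
  have "(hd xs, last xs) \<in> (adj G (set (x # xs)))\<^sup>*"
    using cons.IH[OF *(2)] adj_rtrancl_mono[of "set xs" "set (x # xs)" G] by auto
  moreover have "(x, hd xs) \<in> adj G (set (x # xs))"
    using *(1) cons.hyps by (simp add: adj_def)
  ultimately show ?case
    using cons.hyps by (simp add: converse_rtrancl_into_rtrancl)
qed simp

text \<open>
  It suffices to link the two rays outside every finite set. If \<open>S\<close> is given, then a
  path that avoids not only \<open>S\<close> but also suitable initial segments of both rays joins
  their tails.
\<close>

lemma ray_equivI:
  assumes x: "x \<in> rays G" and y: "y \<in> rays G"
    and link: "\<And>F. finite F \<Longrightarrow> \<exists>u\<in>range x - F. \<exists>v\<in>range y - F. (u, v) \<in> (adj G (- F))\<^sup>*"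
  shows "(x, y) \<in> ray_equiv G"
proof -
  have "\<exists>C\<in>components (delete_verts G S). \<exists>m n. x ` {m..} \<subseteq> C \<and> y ` {n..} \<subseteq> C" if S: "finite S" for S
  proof -
    let ?D = "delete_verts G S"
    obtain C m where C: "C \<in> components ?D" "x ` {m..} \<subseteq> C" using ray_tail_in_component[OF x S] by blast
    obtain D n where D: "D \<in> components ?D" "y ` {n..} \<subseteq> D" using ray_tail_in_component[OF y S] by blast
    let ?F = "S \<union> x ` {..<m} \<union> y ` {..<n}"
    obtain u v where uv: "u \<in> range x - ?F" "v \<in> range y - ?F" "(u, v) \<in> (adj G (- ?F))\<^sup>*"
      using link[of ?F] S by auto
    have "u \<in> C" "v \<in> D" using uv C(2) D(2) by (force simp: not_less)+
    moreover have "adj G (- ?F) \<subseteq> {(a, b). {a, b} \<in> edges ?D}"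
      by (auto simp: adj_def delete_verts_def)
    then have "(u, v) \<in> {(a, b). {a, b} \<in> edges ?D}\<^sup>*"
      using uv(3) rtrancl_mono by blast
    then have "(u, v) \<in> linked ?D"
      using uv x y by (auto simp: linked_def delete_verts_def rays_def)
    ultimately have "C = D"
      using quotient_eqI[OF equiv_linked] C(1) D(1) unfolding components_def by metis
    then show ?thesis using C D by blast
  qed
  then show ?thesis using x y by (simp add: ray_equiv_def)
qed

text \<open>
  The columns of the subdivided grid are disjoint rays. Two neighbouring columns are equivalent,
  because a finite set cannot meet all of the infinitely many disjoint rungs between them.
\<close>

theorem hex_minor_thick_end:
  assumes G: "simple_graph G" and minor: "topological_minor hex_quarter_grid G"
  shows "\<exists>\<omega>\<in>ends G. thick \<omega>"
proof -
  let ?X = hex_quarter_grid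
  obtain \<phi> P where inj: "inj_on \<phi> (verts ?X)"
    and P: "\<And>e. e \<in> edges ?X \<Longrightarrow> path_list (P e)"
    and ends: "\<And>e. e \<in> edges ?X \<Longrightarrow> {hd (P e), last (P e)} = \<phi> ` e"
    and inner: "\<And>e. e \<in> edges ?X \<Longrightarrow> inner_verts (P e) \<inter> \<phi> ` verts ?X = {}"
    and disj: "\<And>e f. e \<in> edges ?X \<Longrightarrow> f \<in> edges ?X \<Longrightarrow> e \<noteq> f \<Longrightarrow> inner_verts (P e) \<inter> inner_verts (P f) = {}"
    and sub: "\<And>e. e \<in> edges ?X \<Longrightarrow> path_edges (P e) \<subseteq> edges G"
  proof -
    obtain H where H: "subgraph H G" "subdivision_of ?X H" using minor by (auto simp: topological_minor_def)
    obtain \<phi> P where *: "inj_on \<phi> (verts ?X)"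
      "\<forall>e\<in>edges ?X. path_list (P e) \<and> {hd (P e), last (P e)} = \<phi> ` e \<and> inner_verts (P e) \<inter> \<phi> ` verts ?X = {}"
      "\<forall>e\<in>edges ?X. \<forall>f\<in>edges ?X. e \<noteq> f \<longrightarrow> inner_verts (P e) \<inter> inner_verts (P f) = {}"
      "edges H = (\<Union>e\<in>edges ?X. path_edges (P e))"
      using H(2) unfolding subdivision_of_def by (elim exE conjE) (rule that)
    show thesis
    proof (rule that)
      show "inj_on \<phi> (verts ?X)" by fact
      fix e assume e: "e \<in> edges ?X"
      then show "path_list (P e)" "{hd (P e), last (P e)} = \<phi> ` e" "inner_verts (P e) \<inter> \<phi> ` verts ?X = {}"
        using *(2) by simp_all
      show "path_edges (P e) \<subseteq> edges G"
        using e *(4) H(1) unfolding subgraph_def by blast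
      fix f assume "f \<in> edges ?X" "e \<noteq> f"
      then show "inner_verts (P e) \<inter> inner_verts (P f) = {}"
        using e *(3) by simp
    qed
  qed
  have meet: "set (P e) \<inter> set (P f) \<subseteq> \<phi> ` (e \<inter> f)" if ef: "e \<in> edges ?X" "f \<in> edges ?X" "e \<noteq> f" for e f
  proof -
    have V: "e \<subseteq> verts ?X" "f \<subseteq> verts ?X"
      using ef simple_graph_hex_quarter_grid by (auto simp: simple_graph_def)
    have sets: "set (P e) = \<phi> ` e \<union> inner_verts (P e)" "set (P f) = \<phi> ` f \<union> inner_verts (P f)"
      using set_path_list[OF P] ends ef by metis+
    have disj_Un: "(A \<union> I) \<inter> (B \<union> J) \<subseteq> A \<inter> B"
      if "I \<inter> W = {}" "J \<inter> W = {}" "I \<inter> J = {}" "A \<subseteq> W" "B \<subseteq> W" for A B I J W :: "'a set"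
      using that by blast
    have "set (P e) \<inter> set (P f) \<subseteq> \<phi> ` e \<inter> \<phi> ` f"
      unfolding sets
      by (rule disj_Un[OF inner[OF ef(1)] inner[OF ef(2)] disj[OF ef] image_mono[OF V(1)] image_mono[OF V(2)]])
    then show ?thesis using inj_on_image_Int[OF inj V] by simp
  qed
  define V where "V n m = {(n, m), (n, Suc m)}" for n m :: nat
  define H where "H n m = {(n, m), (Suc n, m)}" for n m :: nat
  have V: "V n m \<in> edges ?X" if "n < m" for n m
    unfolding edges_hex V_def
    by (rule UnI1, rule CollectI, rule exI[of _ n], rule exI[of _ m]) (use that in simp)
  have H: "H n m \<in> edges ?X" if "n < m" "odd (n + m)" for n m
    unfolding edges_hex H_def
    by (rule UnI2, rule CollectI, rule exI[of _ n], rule exI[of _ m]) (use that in simp)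
  \<comment> \<open>The path of a vertical edge, oriented upwards.\<close>
  define Q where "Q n m = (if hd (P (V n m)) = \<phi> (n, m) then P (V n m) else rev (P (V n m)))" for n m
  have Q: "path_list (Q n m)" "hd (Q n m) = \<phi> (n, m)" "last (Q n m) = \<phi> (n, Suc m)"
    "set (Q n m) = set (P (V n m))" "path_edges (Q n m) \<subseteq> edges G" if "n < m" for n m
  proof -
    have e: "{hd (P (V n m)), last (P (V n m))} = {\<phi> (n, m), \<phi> (n, Suc m)}"
      using ends[OF V[OF that]] by (simp add: V_def)
    have ne: "P (V n m) \<noteq> []" using P[OF V[OF that]] by (auto simp: path_list_def)
    show "path_list (Q n m)" "set (Q n m) = set (P (V n m))" "path_edges (Q n m) \<subseteq> edges G"
      using P[OF V[OF that]] sub[OF V[OF that]] by (auto simp: Q_def path_list_def path_edges_rev)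
    show "hd (Q n m) = \<phi> (n, m)" "last (Q n m) = \<phi> (n, Suc m)"
      using e ne by (auto simp: Q_def doubleton_eq_iff hd_rev last_rev)
  qed
  \<comment> \<open>Column \<open>n\<close> is taken from row \<open>n + 1\<close> on, which avoids the deleted corner \<open>(0, 0)\<close>; the last vertex of each path is dropped since it starts the next one.\<close>
  have "\<exists>x. x \<in> rays G \<and> range x = (\<Union>k. set (butlast (Q n (Suc n + k))))" for n
  proof -
    define L where "L k = butlast (Q n (Suc n + k))" for k
    have lt: "n < Suc n + k" for k by simp
    have Qk: "Q n (Suc n + k) = L k @ [\<phi> (n, Suc (Suc n + k))]" "distinct (Q n (Suc n + k))" for k
    proof -
      have "Q n (Suc n + k) \<noteq> []" using Q(1)[OF lt, of k] by (auto simp: path_list_def)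
      then show "Q n (Suc n + k) = L k @ [\<phi> (n, Suc (Suc n + k))]"
        unfolding L_def Q(3)[OF lt, of k, symmetric] by (rule append_butlast_last_id[symmetric])
      show "distinct (Q n (Suc n + k))" using Q(1)[OF lt, of k] by (simp add: path_list_def)
    qed
    obtain x where "x \<in> rays G" "range x = (\<Union>k. set (L k))"
    proof (rule spliced_ray[OF G, of L])
      fix k
      show ne: "L k \<noteq> []" for k
        using Q(1)[OF lt, of k] Qk(1)[of k] by (auto simp: path_list_def)
      show "distinct (L k)" using Qk[of k] by simp
      have "successively (\<lambda>u v. {u, v} \<in> edges G) (L k @ [\<phi> (n, Suc (Suc n + k))])"
        using Q(5)[OF lt, of k] Qk(1)[of k] by (simp add: successively_path_edges)
      then have "successively (\<lambda>u v. {u, v} \<in> edges G) (L k)" "{last (L k), \<phi> (n, Suc (Suc n + k))} \<in> edges G"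
        using ne[of k] by (auto simp: successively_append_iff)
      moreover have "hd (L (Suc k)) = \<phi> (n, Suc (Suc n + k))"
        using Q(2)[OF lt, of "Suc k"] Qk(1)[of "Suc k"] ne[of "Suc k"] by simp
      ultimately show "path_edges (L k) \<subseteq> edges G" "{last (L k), hd (L (Suc k))} \<in> edges G"
        by (simp_all add: successively_path_edges)
    next
      fix j k :: nat assume jk: "j < k"
      have "set (Q n (Suc n + j)) \<inter> set (Q n (Suc n + k)) \<subseteq> \<phi> ` (V n (Suc n + j) \<inter> V n (Suc n + k))"
        unfolding Q(4)[OF lt] using jk by (intro meet V lt) (auto simp: V_def doubleton_eq_iff)
      also have "\<dots> \<subseteq> {\<phi> (n, Suc (Suc n + j))}"
        using jk by (auto simp: V_def)
      finally show "set (L j) \<inter> set (L k) = {}"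
        using Qk[of j] Qk(1)[of k] by auto
    qed
    then show ?thesis unfolding L_def by blast
  qed
  then obtain x where x: "\<And>n. x n \<in> rays G"
    and range_x: "\<And>n. range (x n) = (\<Union>k. set (butlast (Q n (Suc n + k))))" by metis
  have branch_x: "\<phi> (n, m) \<in> range (x n)" if "n < m" for n m
  proof -
    have "\<phi> (n, m) \<in> set (butlast (Q n m))"
      using Q(1,2)[OF that] by (cases "Q n m") (auto simp: path_list_def)
    moreover have "m = Suc n + (m - Suc n)" using that by simp
    ultimately show ?thesis unfolding range_x by (metis UN_iff UNIV_I)
  qed
  have x_sub: "range (x n) \<subseteq> (\<Union>m\<in>{n<..}. set (P (V n m)))" for n
    unfolding range_x using Q(4)[of n] by (force dest: in_set_butlastD)
  have disjoint: "range (x n) \<inter> range (x n') = {}" if "n \<noteq> n'" for n n'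
  proof -
    have paths: "set (P (V n m)) \<inter> set (P (V n' m')) = {}" if "n < m" "n' < m'" for m m'
    proof -
      have "V n m \<inter> V n' m' = {}" using \<open>n \<noteq> n'\<close> by (auto simp: V_def)
      moreover have "V n m \<noteq> V n' m'" using \<open>n \<noteq> n'\<close> by (simp add: V_def doubleton_eq_iff)
      ultimately show ?thesis using meet[OF V V] that by fastforce
    qed
    show ?thesis
    proof (rule equals0I)
      fix y assume y: "y \<in> range (x n) \<inter> range (x n')"
      then obtain m where "n < m" "y \<in> set (P (V n m))" using x_sub[of n] by blast
      moreover obtain m' where "n' < m'" "y \<in> set (P (V n' m'))" using y x_sub[of n'] by blast
      ultimately show False using paths by blast
    qed
  qed
  have next_equiv: "(x n, x (Suc n)) \<in> ray_equiv G" for n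
  proof (rule ray_equivI[OF x x])
    fix F :: "'a set" assume F: "finite F"
    \<comment> \<open>Rungs between columns \<open>n\<close> and \<open>n + 1\<close> exist in every second row; column \<open>n + 1\<close> is taken from row \<open>n + 2\<close> on.\<close>
    define h where "h k = H n (n + 3 + 2 * k)" for k
    have h: "h k \<in> edges ?X" for k unfolding h_def by (rule H) auto
    have "\<exists>k. set (P (h k)) \<inter> F = {}"
    proof (rule ccontr)
      assume "\<not> ?thesis"
      then have "\<forall>k. \<exists>y. y \<in> set (P (h k)) \<inter> F" by blast
      then obtain g where g: "\<And>k. g k \<in> set (P (h k)) \<inter> F" by metis
      have "g j \<noteq> g k" if "j < k" for j k
      proof -
        have "h j \<inter> h k = {}" using that by (auto simp: h_def H_def)
        moreover have "h j \<noteq> h k" using that by (simp add: h_def H_def doubleton_eq_iff)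
        ultimately have "set (P (h j)) \<inter> set (P (h k)) = {}" using meet[OF h h] by fastforce
        then show ?thesis using g[of j] g[of k] by auto
      qed
      then have "inj g" by (rule linorder_injI)
      moreover have "range g \<subseteq> F" using g by auto
      ultimately show False using F infinite_iff_countable_subset by blast
    qed
    then obtain k where k: "set (P (h k)) \<inter> F = {}" by blast
    have ne: "P (h k) \<noteq> []" using P[OF h, of k] by (auto simp: path_list_def)
    have "(hd (P (h k)), last (P (h k))) \<in> (adj G (- F))\<^sup>*"
      using path_linked[OF ne sub[OF h]] adj_rtrancl_mono[of "set (P (h k))" "- F" G] k by blast
    then have l: "(hd (P (h k)), last (P (h k))) \<in> (adj G (- F))\<^sup>*" "(last (P (h k)), hd (P (h k))) \<in> (adj G (- F))\<^sup>*"
      by (auto intro: adj_rtrancl_sym)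
    have off: "hd (P (h k)) \<notin> F" "last (P (h k)) \<notin> F"
      using k ne hd_in_set last_in_set by blast+
    have on: "\<phi> (n, n + 3 + 2 * k) \<in> range (x n)" "\<phi> (Suc n, n + 3 + 2 * k) \<in> range (x (Suc n))"
      by (rule branch_x; simp)+
    have "{hd (P (h k)), last (P (h k))} = {\<phi> (n, n + 3 + 2 * k), \<phi> (Suc n, n + 3 + 2 * k)}"
      using ends[OF h, of k] by (simp add: h_def H_def)
    then consider "hd (P (h k)) = \<phi> (n, n + 3 + 2 * k)" "last (P (h k)) = \<phi> (Suc n, n + 3 + 2 * k)"
      | "hd (P (h k)) = \<phi> (Suc n, n + 3 + 2 * k)" "last (P (h k)) = \<phi> (n, n + 3 + 2 * k)"
      by (auto simp: doubleton_eq_iff)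
    then show "\<exists>u\<in>range (x n) - F. \<exists>v\<in>range (x (Suc n)) - F. (u, v) \<in> (adj G (- F))\<^sup>*"
      using l off on by cases (metis DiffI)+
  qed
  have equiv: "(x 0, x n) \<in> ray_equiv G" for n
  proof (induction n)
    case 0
    show ?case using equiv_ray_equiv[of G] x by (auto simp: equiv_def refl_on_def)
  next
    case (Suc n)
    then show ?case using equiv_ray_equiv[of G] next_equiv[of n] by (meson equivE transD)
  qed
  let ?\<omega> = "ray_equiv G `` {x 0}"
  have "?\<omega> \<in> ends G" using x by (simp add: ends_def quotientI)
  moreover have "inj x"
    using disjoint by (intro injI) (metis Int_absorb UNIV_not_empty image_is_empty)
  then have "infinite (range x)" by (rule range_inj_infinite)
  moreover have "range x \<subseteq> ?\<omega>" using equiv by auto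
  moreover have "pairwise (\<lambda>x y. disjnt (range x) (range y)) (range x)"
  proof (rule pairwiseI)
    fix y z assume "y \<in> range x" "z \<in> range x" "y \<noteq> z"
    then obtain i j where "y = x i" "z = x j" "i \<noteq> j" by blast
    then show "disjnt (range y) (range z)" using disjoint by (simp add: disjnt_def)
  qed
  ultimately show ?thesis unfolding thick_def by blast
qed

theorem mainTheorem1:
  fixes G :: "'a graph"
  assumes "simple_graph G" and "infinite (verts G)"
  shows "(\<exists>\<omega>\<in>ends G. thick \<omega>) \<longleftrightarrow> topological_minor hex_quarter_grid G"
  using thick_end_hex_minor[OF assms(1)] hex_minor_thick_end[OF assms(1)] by blast

end
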